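(* Every (matrix) Lie group $G$ supports an analytic left-invariant measure: there exists a nonzero left-invariant Borel measure $m$ on $G$ such that for every coordinate chart $\phi:\mathcal{O}\to G$ there is a (real) analytic function $\delta_\phi:\mathcal{O}\to\mathbb{R}^+$ with $$\int_G f\,dm=\int_{\mathcal{O}} f(\phi(x))\,\delta_\phi(x)\,dx$$ for every $f\in C_c(G)$ with support contained in $\phi(\mathcal{O})$.
   Context: A (matrix) Lie group is a closed subgroup of $\mathrm{GL}_d(\mathbb{R})$. Let $\mathcal{L}(G)=\{X\in\mathrm{M}_d(\mathbb{R}):\exp(tX)\in G\ \forall t\in\mathbb{R}\}$ be its Lie algebra, a real vector space, identified with $\mathbb{R}^n$, $n=\dim\mathcal{L}(G)$, by a choice of basis; $dx$ is Lebesgue measure on it. Fix a sufficiently small open neighbourhood $\mathcal{U}$ of $0$ in $\mathrm{M}_d(\mathbb{R})$ such that $\exp:\mathcal{U}\to\exp(\mathcal{U})$ is an analytic bijection with analytic inverse, and such that, with $\mathcal{O}=\mathcal{L}(G)\cap\mathcal{U}$, the set $\exp(\mathcal{O})$ is a neighbourhood of the identity in $G$. The coordinate charts of $G$ are the maps $\phi:\mathcal{O}\to G$, $\phi(x)=g\exp(x)$, for $g\in G$. A measure $m$ on $G$ is left-invariant if $\int_G f(gx)\,dm(x)=\int_G f(x)\,dm(x)$ for all $g\in G$, $f\in C_c(G)$. A measure is called analytic if it is given in coordinate charts by analytic densities as in the claim. $\mathbb{R}^+$ denotes the positive reals. *)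

theory Defs
  imports "HOL-Analysis.Analysis"
begin

section \<open>Matrix Lie groups and their Lie algebras\<close>

text \<open>The ring operations on \<^typ>\<open>real^'d^'d\<close> provided by the library are componentwise, so the
  library exponential does not apply to matrices.\<close>

definition matrix_power :: "real^'d^'d \<Rightarrow> nat \<Rightarrow> real^'d^'d" where
  "matrix_power A k = (((**) A) ^^ k) (mat 1)"

definition mexp :: "real^'d^'d \<Rightarrow> real^'d^'d" where
  "mexp A = (\<Sum>k. (1 / fact k) *\<^sub>R matrix_power A k)"

definition matrix_lie_group :: "(real^'d^'d) set \<Rightarrow> bool" where
  "matrix_lie_group G \<longleftrightarrow>
     closedin (top_of_set {A. invertible A}) G \<and>
     mat 1 \<in> G \<and>
     (\<forall>A\<in>G. \<forall>B\<in>G. A ** B \<in> G) \<and>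
     (\<forall>A\<in>G. matrix_inv A \<in> G)"

definition lie_algebra :: "(real^'d^'d) set \<Rightarrow> (real^'d^'d) set" where
  "lie_algebra G = {X. \<forall>t. mexp (t *\<^sub>R X) \<in> G}"

section \<open>Analyticity and Lebesgue measure in linear coordinates\<close>

text \<open>A finite linearly independent set \<open>B\<close> identifies \<open>span B\<close> with the coordinate space
  \<open>\<real>\<^sup>B\<close>; this covers \<open>B = {}\<close>, where \<open>span B = {0}\<close>. Multi-indices are the functions
  \<open>\<alpha> : B \<rightarrow> \<nat>\<close>. \<open>f\<close> is real analytic on \<open>S\<close> if around every point of \<open>S\<close> there is a coordinate
  cube contained in \<open>S\<close> on which \<open>f\<close> is the sum of a (multivariate) power series; in
  particular \<open>S\<close> is required to be open in the directions of \<open>span B\<close>.\<close>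

definition real_analytic_on ::
  "'a::euclidean_space set \<Rightarrow> ('a \<Rightarrow> 'b::euclidean_space) \<Rightarrow> 'a set \<Rightarrow> bool" where
  "real_analytic_on B f S \<longleftrightarrow>
     (\<forall>a\<in>S. \<exists>r>0. \<exists>c :: ('a \<Rightarrow> nat) \<Rightarrow> 'b. \<forall>t :: 'a \<Rightarrow> real.
        (\<forall>v\<in>B. \<bar>t v\<bar> < r) \<longrightarrow>
          a + (\<Sum>v\<in>B. t v *\<^sub>R v) \<in> S \<and>
          ((\<lambda>\<alpha>. (\<Prod>v\<in>B. t v ^ \<alpha> v) *\<^sub>R c \<alpha>) has_sum f (a + (\<Sum>v\<in>B. t v *\<^sub>R v)))
            (B \<rightarrow>\<^sub>E UNIV))"

text \<open>Lebesgue measure on \<open>span B\<close>: the image of the product Lebesgue measure on \<open>\<real>\<^sup>B\<close> under the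
  coordinate isomorphism, regarded as a Borel measure on the ambient space that is concentrated on
  \<open>span B\<close>. For \<open>B = {}\<close> it is the point mass at \<open>0\<close>.\<close>

definition coord_lebesgue :: "'a::euclidean_space set \<Rightarrow> 'a measure" where
  "coord_lebesgue B =
     distr (Pi\<^sub>M B (\<lambda>_. lborel :: real measure)) borel (\<lambda>t. \<Sum>v\<in>B. t v *\<^sub>R v)"

section \<open>Exponential charts\<close>

text \<open>The conditions on the neighbourhood \<open>U\<close> of \<open>0\<close> in the space of all matrices; the chart domain is
  \<open>lie_algebra G \<inter> U\<close>, and the charts are \<open>x \<mapsto> g ** mexp x\<close> for \<open>g \<in> G\<close>.\<close>

definition exp_neighbourhood :: "(real^'d^'d) set \<Rightarrow> (real^'d^'d) set \<Rightarrow> bool" where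
  "exp_neighbourhood G U \<longleftrightarrow>
     open U \<and> 0 \<in> U \<and> inj_on mexp U \<and>
     real_analytic_on Basis mexp U \<and>
     real_analytic_on Basis (inv_into U mexp) (mexp ` U) \<and>
     (\<exists>V. openin (top_of_set G) V \<and> mat 1 \<in> V \<and> V \<subseteq> mexp ` (lie_algebra G \<inter> U))"

section \<open>Left-invariant Borel measures\<close>

definition supp_in :: "'a::topological_space set \<Rightarrow> ('a \<Rightarrow> real) \<Rightarrow> 'a set" where
  "supp_in G f = G \<inter> closure {x \<in> G. f x \<noteq> 0}"

text \<open>Functions on \<open>G\<close> are represented by functions on the ambient space, whose values outside \<open>G\<close>
  are irrelevant.\<close>

definition Cc :: "'a::topological_space set \<Rightarrow> ('a \<Rightarrow> real) set" where
  "Cc G = {f. continuous_on G f \<and> compact (supp_in G f)}"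

text \<open>Finiteness on compact sets is what makes every function in \<open>Cc G\<close> integrable; without it the
  Bochner integral would silently take the value \<open>0\<close> on non-integrable functions.\<close>

definition borel_measure_on :: "'a::topological_space set \<Rightarrow> 'a measure \<Rightarrow> bool" where
  "borel_measure_on G m \<longleftrightarrow>
     sets m = sets (restrict_space borel G) \<and>
     (\<forall>K. compact K \<and> K \<subseteq> G \<longrightarrow> emeasure m K < \<infinity>)"

definition left_invariant :: "(real^'d^'d) set \<Rightarrow> (real^'d^'d) measure \<Rightarrow> bool" where
  "left_invariant G m \<longleftrightarrow>
     (\<forall>g\<in>G. \<forall>f\<in>Cc G. (\<integral>x. f (g ** x) \<partial>m) = (\<integral>x. f x \<partial>m))"

end

theory Submission
  imports Defs
begin

text \<open>Left multiplication by a matrix \<open>g\<close> is a linear map of the space of all matrices, so it multiplies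
Lebesgue measure there by a constant \<open>c g\<close> (\<open>left_scale\<close>), and \<open>c\<close> is multiplicative. An invariant measure on \<open>G\<close> is
obtained by thickening \<open>G\<close> to an open set of matrices and pushing Lebesgue measure back down; this needs
neither a partition of unity nor a comparison of overlapping charts.

Write \<open>L\<close> for the Lie algebra and choose a linear projection \<open>P\<close> onto \<open>L\<close>, with kernel \<open>N\<close>. For a small
disc \<open>D\<close> around \<open>0\<close> in \<open>N\<close>, every matrix of the tube \<open>G (1 + D)\<close> is \<open>g (1 + n)\<close> for exactly one pair
\<open>(g, n)\<close> (lemma \<open>tube_radius\<close>): if \<open>g (1 + n) = g' (1 + n')\<close>, then \<open>g'\<inverse> g\<close> is close to \<open>1\<close>, so it
is \<open>exp x\<close> with \<open>x \<in> L\<close> small, and the map \<open>x + n \<mapsto> exp x (1 + n)\<close> is injective near \<open>0\<close> because its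
derivative there is the identity. By invariance of domain the tube is open and the foot point map
\<open>g (1 + n) \<mapsto> g\<close> is continuous. The tube is stable under left multiplication by \<open>G\<close>, and the foot point map commutes with it. Hence the image of the
measure \<open>dX / c (foot X)\<close> on the tube under the foot point map is left-invariant
(\<open>left_invariant_haar\<close>); it is finite on compact sets since \<open>K (1 + D)\<close> is bounded for compact \<open>K\<close>.

In the chart \<open>x \<mapsto> g exp x\<close> the tube is parametrised by \<open>x + n \<mapsto> g exp x (1 + n)\<close>. The derivative of
this map is the composition of three linear maps: the map \<open>A x \<oplus> id\<close> on \<open>L \<oplus> N\<close>, where
\<open>A x y = exp (-x) (D exp)(x) y\<close>, a map that depends on \<open>n\<close> only, and multiplication by \<open>g exp x\<close>.
For this it is essential that \<open>A x\<close> maps \<open>L\<close> to \<open>L\<close> (\<open>left_dmexp_in_L\<close>): \<open>A x y\<close> is the velocity at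
\<open>1\<close> of a curve in \<open>G\<close>, whose logarithm lies in \<open>L\<close>. The scaling factor of the third map cancels against
\<open>c (foot X)\<close>, the second one integrates over \<open>D\<close> to a constant \<open>\<kappa>\<close>, and what remains is the density
\<open>\<delta> x = \<kappa> \<bar>det (A x \<oplus> id)\<bar>\<close>, the same for every \<open>g\<close> (\<open>integral_haar_chart\<close>).

The density is positive because the inverse of \<open>exp\<close> on \<open>U\<close> is analytic, hence Lipschitz at each point,
so that \<open>(D exp)(x)\<close> is injective. It is analytic because the entries of \<open>exp (-x)\<close> and \<open>(D exp)(x) y\<close>
are everywhere convergent power series in the coordinates of \<open>x\<close>, and absolutely convergent power series
on a cube are closed under sums, products and normally convergent series; the absolute value only
contributes a locally constant sign.\<close>

section \<open>Coordinates on a Euclidean space\<close>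

text \<open>A finite and well-ordered type of cardinality \<open>DIM('a)\<close>. It makes every Euclidean space \<open>'a\<close>, here
the space of matrices, isomorphic to some \<open>real^'n\<close> with a well-ordered index type, which is the setting
of the change of variables theorem \<open>has_absolute_integral_change_of_variables\<close>.\<close>

typedef (overloaded) 'a coord_index = "{..<DIM('a::euclidean_space)}"
  using DIM_positive by blast

instantiation coord_index :: (euclidean_space) wellorder
begin

definition less_eq_coord_index :: "'a coord_index \<Rightarrow> 'a coord_index \<Rightarrow> bool" where
  "i \<le> j \<longleftrightarrow> Rep_coord_index i \<le> Rep_coord_index j"

definition less_coord_index :: "'a coord_index \<Rightarrow> 'a coord_index \<Rightarrow> bool" where
  "i < j \<longleftrightarrow> Rep_coord_index i < Rep_coord_index j"

instance
proof
  fix Q :: "'a coord_index \<Rightarrow> bool" and a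
  assume step: "\<And>x. (\<And>y. y < x \<Longrightarrow> Q y) \<Longrightarrow> Q x"
  show "Q a"
    by (induction a rule: measure_induct_rule[where f = Rep_coord_index])
      (use step in \<open>auto simp: less_coord_index_def\<close>)
qed (auto simp: less_eq_coord_index_def less_coord_index_def Rep_coord_index_inject)

end

instance coord_index :: (euclidean_space) finite
proof
  have "(UNIV :: 'a coord_index set) = Abs_coord_index ` {..<DIM('a)}"
    using type_definition.univ[OF type_definition_coord_index] by blast
  then show "finite (UNIV :: 'a coord_index set)"
    by (metis finite_imageI finite_lessThan)
qed

lemma card_coord_index: "CARD('a::euclidean_space coord_index) = DIM('a)"
  using type_definition.card[OF type_definition_coord_index] by simp

lemma exists_basis_coordinates:
  fixes C :: "'a::euclidean_space set"
  assumes "independent C" "span C = UNIV"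
  obtains T :: "real^('a coord_index) \<Rightarrow> 'a" where "linear T" "bij T" "bij_betw T Basis C"
proof -
  have "DIM(real^('a coord_index)) = card C"
    using assms by (metis DIM_cart DIM_real card_coord_index basis_card_eq_dim dim_UNIV subset_UNIV
        mult.right_neutral)
  then obtain h :: "real^('a coord_index) \<Rightarrow> 'a" where h: "bij_betw h Basis C"
    using finite_same_card_bij[of "Basis :: (real^('a coord_index)) set" C] finiteI_independent[OF assms(1)] by auto
  obtain T where T: "linear T" "\<forall>b\<in>Basis. T b = h b"
    using linear_independent_extend[OF independent_Basis] by blast
  obtain T' where T': "linear T'" "\<forall>v\<in>C. T' v = inv_into Basis h v"
    using linear_independent_extend[OF assms(1)] by blast
  have "T (T' v) = v" for v
  proof (rule linear_eq_on_span[of "\<lambda>v. T (T' v)" "\<lambda>v. v" C])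
    show "T (T' v) = v" if "v \<in> C" for v
      using that T T' h by (simp add: bij_betw_inv_into_right bij_betw_apply[OF bij_betw_inv_into])
  qed (use T T' assms in \<open>auto intro: linear_compose[unfolded o_def] linear_ident\<close>)
  moreover have "T' (T k) = k" for k
  proof (rule linear_eq_on_span[of "\<lambda>v. T' (T v)" "\<lambda>v. v" Basis])
    show "T' (T b) = b" if "b \<in> Basis" for b
      using that T T' h by (simp add: bij_betw_inv_into_left bij_betw_apply)
  qed (use T T' in \<open>auto intro: linear_compose[unfolded o_def] linear_ident\<close>)
  ultimately have "bij T"
    by (metis bijI' )
  moreover have "bij_betw T Basis C"
    using h T by (metis bij_betw_cong)
  ultimately show ?thesis
    using that T by blast
qed

section \<open>Lebesgue measure in linear coordinates\<close>

interpretation lborel_product: product_sigma_finite "\<lambda>_. lborel :: real measure"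
  by standard

text \<open>The two products have the same value on boxes, because a bijection of the index sets only permutes the
factors.\<close>

lemma PiM_lborel_reindex:
  fixes h :: "'i \<Rightarrow> 'j"
  assumes h: "bij_betw h I J" and "finite I"
  shows "distr (Pi\<^sub>M J (\<lambda>_. lborel :: real measure)) (Pi\<^sub>M I (\<lambda>_. lborel)) (\<lambda>\<omega>. \<lambda>i\<in>I. \<omega> (h i))
    = Pi\<^sub>M I (\<lambda>_. lborel)"
proof (rule lborel_product.PiM_eqI)
  have hJ: "h i \<in> J" if "i \<in> I" for i
    using h that by (auto simp: bij_betw_def)
  have finJ: "finite J"
    using assms bij_betw_finite by blast
  have meas: "(\<lambda>\<omega>. \<lambda>i\<in>I. \<omega> (h i)) \<in> Pi\<^sub>M J (\<lambda>_. lborel :: real measure) \<rightarrow>\<^sub>M Pi\<^sub>M I (\<lambda>_. lborel)"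
    by (intro measurable_restrict measurable_component_singleton hJ)
  fix A :: "'i \<Rightarrow> real set"
  assume A: "\<And>i. i \<in> I \<Longrightarrow> A i \<in> sets lborel"
  let ?h' = "inv_into I h"
  have h': "?h' (h i) = i" if "i \<in> I" for i
    using that h by (simp add: bij_betw_inv_into_left)
  have "(\<lambda>\<omega>. \<lambda>i\<in>I. \<omega> (h i)) -` (\<Pi>\<^sub>E i\<in>I. A i) \<inter> space (Pi\<^sub>M J (\<lambda>_. lborel :: real measure))
      = (\<Pi>\<^sub>E j\<in>J. A (?h' j))"
    using h h' by (auto simp: space_PiM PiE_iff bij_betw_def restrict_def; metis imageE)
  then have "emeasure (distr (Pi\<^sub>M J (\<lambda>_. lborel)) (Pi\<^sub>M I (\<lambda>_. lborel)) (\<lambda>\<omega>. \<lambda>i\<in>I. \<omega> (h i))) (\<Pi>\<^sub>E i\<in>I. A i)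
      = emeasure (Pi\<^sub>M J (\<lambda>_. lborel)) (\<Pi>\<^sub>E j\<in>J. A (?h' j))"
    using A by (simp add: emeasure_distr[OF meas] sets_PiM_I_finite \<open>finite I\<close>)
  also have "\<dots> = (\<Prod>j\<in>J. emeasure lborel (A (?h' j)))"
    using A h by (intro lborel_product.emeasure_PiM finJ) (auto simp: bij_betw_def intro!: A inv_into_into)
  also have "\<dots> = (\<Prod>i\<in>I. emeasure lborel (A i))"
    using prod.reindex_bij_betw[OF h, of "\<lambda>j. emeasure lborel (A (?h' j))"] h' by simp
  finally show "emeasure (distr (Pi\<^sub>M J (\<lambda>_. lborel)) (Pi\<^sub>M I (\<lambda>_. lborel)) (\<lambda>\<omega>. \<lambda>i\<in>I. \<omega> (h i))) (\<Pi>\<^sub>E i\<in>I. A i)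
      = (\<Prod>i\<in>I. emeasure lborel (A i))" .
qed (use \<open>finite I\<close> in auto)

lemma measurable_coord_sum [measurable]:
  fixes B :: "'a::euclidean_space set"
  shows "(\<lambda>t. \<Sum>v\<in>B. t v *\<^sub>R v) \<in> Pi\<^sub>M B (\<lambda>_. lborel :: real measure) \<rightarrow>\<^sub>M borel"
proof (rule borel_measurable_sum)
  fix v assume "v \<in> B"
  then have "(\<lambda>t. t v) \<in> Pi\<^sub>M B (\<lambda>_. lborel :: real measure) \<rightarrow>\<^sub>M lborel"
    by (rule measurable_component_singleton)
  then show "(\<lambda>t. t v *\<^sub>R v) \<in> Pi\<^sub>M B (\<lambda>_. lborel :: real measure) \<rightarrow>\<^sub>M borel"
    by simp
qed

lemma sets_coord_lebesgue [simp, measurable_cong]: "sets (coord_lebesgue B) = sets borel"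
  by (simp add: coord_lebesgue_def)

lemma space_coord_lebesgue [simp]: "space (coord_lebesgue B) = UNIV"
  by (simp add: coord_lebesgue_def)

lemma coord_lebesgue_Basis: "coord_lebesgue Basis = (lborel :: 'a::euclidean_space measure)"
  unfolding coord_lebesgue_def by (rule lborel_eq[symmetric])

lemma borel_measurable_linear:
  fixes f :: "'a::euclidean_space \<Rightarrow> 'b::euclidean_space"
  assumes "linear f"
  shows "f \<in> borel_measurable borel"
  by (intro borel_measurable_continuous_onI linear_continuous_on)
    (use assms linear_conv_bounded_linear in blast)

text \<open>With \<open>B = Basis\<close> this identifies coordinate Lebesgue measure for an arbitrary basis \<open>C\<close> with the
image of \<open>lborel\<close> under the linear map that carries \<open>Basis\<close> to \<open>C\<close>.\<close>

lemma coord_lebesgue_linear_image: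
  fixes M :: "'a::euclidean_space \<Rightarrow> 'b::euclidean_space"
  assumes "linear M" "bij_betw M B C" "finite B"
  shows "coord_lebesgue C = distr (coord_lebesgue B) borel M"
proof -
  let ?P = "\<lambda>B. Pi\<^sub>M B (\<lambda>_. lborel :: real measure)"
  let ?r = "\<lambda>\<omega>. \<lambda>i\<in>B. \<omega> (M i)"
  have [measurable]: "M \<in> borel_measurable borel"
    by (rule borel_measurable_linear) fact
  have MC: "M i \<in> C" if "i \<in> B" for i
    using assms that by (auto simp: bij_betw_def)
  have [measurable]: "?r \<in> ?P C \<rightarrow>\<^sub>M ?P B"
    by (intro measurable_restrict measurable_component_singleton MC)
  have "distr (coord_lebesgue B) borel M = distr (?P B) borel (\<lambda>t. M (\<Sum>v\<in>B. t v *\<^sub>R v))"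
    unfolding coord_lebesgue_def by (subst distr_distr) (auto simp: o_def)
  also have "\<dots> = distr (?P C) borel (\<lambda>t. M (\<Sum>v\<in>B. ?r t v *\<^sub>R v))"
    by (subst PiM_lborel_reindex[OF assms(2,3), symmetric], subst distr_distr) (auto simp: o_def)
  also have "\<dots> = coord_lebesgue C"
    unfolding coord_lebesgue_def
  proof (rule distr_cong)
    fix t :: "'b \<Rightarrow> real"
    have "M (\<Sum>v\<in>B. ?r t v *\<^sub>R v) = (\<Sum>v\<in>B. t (M v) *\<^sub>R M v)"
      using assms by (simp add: linear_sum linear_scale)
    also have "\<dots> = (\<Sum>v\<in>C. t v *\<^sub>R v)"
      by (rule sum.reindex_bij_betw) fact
    finally show "M (\<Sum>v\<in>B. ?r t v *\<^sub>R v) = (\<Sum>v\<in>C. t v *\<^sub>R v)" .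
  qed auto
  finally show ?thesis by simp
qed

text \<open>Fubini's theorem for the decomposition of a space into \<open>span B\<close> and \<open>span C\<close>, where \<open>P\<close> is the
projection onto the first summand along the second.\<close>

text \<open>Integrating out the \<open>C\<close> direction as an identity between measures makes the formula true for all
Borel functions \<open>h\<close>, integrable or not.\<close>

lemma nn_integral_coord_lebesgue_split:
  fixes B C :: "'a::euclidean_space set" and F :: "'a \<Rightarrow> ennreal"
  assumes "finite B" "finite C" "B \<inter> C = {}"
    and "linear P" "\<And>v. v \<in> B \<Longrightarrow> P v = v" "\<And>v. v \<in> C \<Longrightarrow> P v = 0"
    and A [measurable]: "A \<in> sets borel" and F [measurable]: "F \<in> borel_measurable borel"
  shows "(\<integral>\<^sup>+z. indicator A (P z) * F (z - P z) \<partial>coord_lebesgue (B \<union> C))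
    = emeasure (coord_lebesgue B) A * (\<integral>\<^sup>+z. F z \<partial>coord_lebesgue C)"
proof -
  let ?P = "\<lambda>B. Pi\<^sub>M B (\<lambda>_. lborel :: real measure)"
  let ?s = "\<lambda>B t. \<Sum>v\<in>B. t v *\<^sub>R v"
  have [measurable]: "P \<in> borel_measurable borel"
    by (rule borel_measurable_linear) fact
  have m1: "?s (B \<union> C) (merge B C (x, y)) = ?s B x + ?s C y" for x y
    using assms by (subst sum.union_disjoint) (auto intro!: arg_cong2[where f="(+)"] sum.cong simp: merge_def)
  have m2: "P (?s B x + ?s C y) = ?s B x" for x y
    using assms by (simp add: linear_add linear_sum linear_scale)
  have "(\<integral>\<^sup>+z. indicator A (P z) * F (z - P z) \<partial>coord_lebesgue (B \<union> C))
     = (\<integral>\<^sup>+t. indicator A (P (?s (B \<union> C) t)) * F (?s (B \<union> C) t - P (?s (B \<union> C) t)) \<partial>?P (B \<union> C))"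
    unfolding coord_lebesgue_def by (subst nn_integral_distr) auto
  also have "\<dots> = (\<integral>\<^sup>+x. \<integral>\<^sup>+y. indicator A (?s B x) * F (?s C y) \<partial>?P C \<partial>?P B)"
    by (subst lborel_product.product_nn_integral_fold)
      (use assms in \<open>auto intro!: nn_integral_cong simp: m1 m2\<close>)
  also have "\<dots> = (\<integral>\<^sup>+x. indicator A (?s B x) \<partial>?P B) * (\<integral>\<^sup>+y. F (?s C y) \<partial>?P C)"
    by (simp add: nn_integral_cmult nn_integral_multc)
  also have "\<dots> = (\<integral>\<^sup>+x. indicator A x \<partial>coord_lebesgue B) * (\<integral>\<^sup>+z. F z \<partial>coord_lebesgue C)"
    unfolding coord_lebesgue_def by (simp add: nn_integral_distr del: nn_integral_indicator)
  finally show ?thesis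
    by simp
qed

lemma integral_coord_lebesgue_split:
  fixes B C :: "'a::euclidean_space set" and F h :: "'a \<Rightarrow> real"
  assumes B: "finite B" "finite C" "B \<inter> C = {}"
    and P: "linear P" "\<And>v. v \<in> B \<Longrightarrow> P v = v" "\<And>v. v \<in> C \<Longrightarrow> P v = 0"
    and F [measurable]: "F \<in> borel_measurable borel" "\<And>z. 0 \<le> F z" and \<kappa>: "0 \<le> \<kappa>"
    and F_int: "(\<integral>\<^sup>+z. F z \<partial>coord_lebesgue C) = ennreal \<kappa>"
    and h [measurable]: "h \<in> borel_measurable borel"
  shows "(\<integral>z. F (z - P z) * h (P z) \<partial>coord_lebesgue (B \<union> C)) = \<kappa> * (\<integral>x. h x \<partial>coord_lebesgue B)"
proof -
  have [measurable]: "P \<in> borel_measurable borel"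
    by (rule borel_measurable_linear) fact
  let ?M = "density (coord_lebesgue (B \<union> C)) (\<lambda>z. F (z - P z))"
  have eq: "distr ?M borel P = density (coord_lebesgue B) (\<lambda>_. \<kappa>)"
  proof (rule measure_eqI)
    fix A assume "A \<in> sets (distr ?M borel P)"
    then have A [measurable]: "A \<in> sets borel" by simp
    have [measurable]: "P -` A \<in> sets borel"
      using measurable_sets_borel[OF _ A] by measurable
    have "emeasure (distr ?M borel P) A
        = (\<integral>\<^sup>+z. ennreal (F (z - P z)) * indicator (P -` A) z \<partial>coord_lebesgue (B \<union> C))"
      by (simp add: emeasure_distr emeasure_density)
    also have "\<dots> = (\<integral>\<^sup>+z. indicator A (P z) * ennreal (F (z - P z)) \<partial>coord_lebesgue (B \<union> C))"
      by (auto intro!: nn_integral_cong simp: indicator_def)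
    also have "\<dots> = emeasure (density (coord_lebesgue B) (\<lambda>_. \<kappa>)) A"
      by (subst nn_integral_coord_lebesgue_split[OF B P])
        (auto simp: F_int emeasure_density nn_integral_cmult mult.commute)
    finally show "emeasure (distr ?M borel P) A = emeasure (density (coord_lebesgue B) (\<lambda>_. \<kappa>)) A" .
  qed simp
  have "(\<integral>z. F (z - P z) * h (P z) \<partial>coord_lebesgue (B \<union> C)) = (\<integral>x. h x \<partial>distr ?M borel P)"
    by (subst integral_distr, measurable) (subst integral_density, auto simp: F(2))
  also have "\<dots> = \<kappa> * (\<integral>x. h x \<partial>coord_lebesgue B)"
    unfolding eq by (subst integral_density) (auto simp: \<kappa>)
  finally show ?thesis .
qed

section \<open>Change of variables\<close>

text \<open>For the Bochner integral no integrability has to be assumed: if one side is not integrable then neither is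
the other, and both integrals have the value \<open>0\<close>.\<close>

lemma lborel_integral_change_of_variables:
  fixes g :: "real^'m::{finite,wellorder} \<Rightarrow> real^'m::_" and h :: "real^'m::_ \<Rightarrow> real"
  assumes S: "S \<in> sets borel"
    and der: "\<And>x. x \<in> S \<Longrightarrow> (g has_derivative g' x) (at x)"
    and inj: "inj_on g S"
    and meas: "(\<lambda>y. indicator (g ` S) y * h y) \<in> borel_measurable borel"
      "(\<lambda>x. indicator S x * (\<bar>det (matrix (g' x))\<bar> * h (g x))) \<in> borel_measurable borel"
  shows "(\<integral>y. indicator (g ` S) y * h y \<partial>lborel)
    = (\<integral>x. indicator S x * (\<bar>det (matrix (g' x))\<bar> * h (g x)) \<partial>lborel)"
proof -
  \<comment> \<open>Scalar integrands are regarded as functions with values in \<open>real^1\<close>.\<close>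
  let ?v = "\<lambda>x. vec x :: real^1"
  let ?k = "\<lambda>x. \<bar>det (matrix (g' x))\<bar> * h (g x)"
  have iff: "?k absolutely_integrable_on S \<and> integral S ?k = b
      \<longleftrightarrow> h absolutely_integrable_on (g ` S) \<and> integral (g ` S) h = b" for b
    using has_absolute_integral_change_of_variables[of S g g' "\<lambda>x. ?v (h x)" "?v b"] S der inj
    by (simp add: absolutely_integrable_on_1_iff integral_on_1_eq has_derivative_at_withinI
        sets_completionI_sets)
  have eq: "(\<integral>x. indicator A x * f x \<partial>lborel) = (if f absolutely_integrable_on A then integral A f else 0)"
    if "(\<lambda>x. indicator A x * f x) \<in> borel_measurable borel" for A and f :: "real^'m::_ \<Rightarrow> real"
  proof -
    have "(\<integral>x. indicator A x * f x \<partial>lborel) = (\<integral>x. indicator A x *\<^sub>R f x \<partial>lebesgue)"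
      using that by (simp add: integral_completion)
    also have "\<dots> = (if f absolutely_integrable_on A then integral A f else 0)"
    proof (cases "f absolutely_integrable_on A")
      case True
      then show ?thesis
        using set_lebesgue_integral_eq_integral(2)[OF True] by (simp add: set_lebesgue_integral_def)
    next
      case False
      then show ?thesis
        unfolding set_integrable_def using not_integrable_integral_eq by auto
    qed
    finally show ?thesis .
  qed
  have "?k absolutely_integrable_on S \<longleftrightarrow> h absolutely_integrable_on (g ` S)"
    and "?k absolutely_integrable_on S \<Longrightarrow> integral S ?k = integral (g ` S) h"
    using iff[of "integral S ?k"] iff[of "integral (g ` S) h"] by argo+
  then show ?thesis
    unfolding eq[OF meas(1)] eq[OF meas(2)] by presburger
qed

text \<open>\<open>T\<close> is a linear isomorphism, used as a choice of coordinates. The value does not depend on it, but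
fixing one avoids a determinant for endomorphisms of an abstract space.\<close>

definition abs_det_wrt :: "(real^'n::finite \<Rightarrow> 'a::real_vector) \<Rightarrow> ('a \<Rightarrow> 'a) \<Rightarrow> real" where
  "abs_det_wrt T f = \<bar>det (matrix (inv T \<circ> f \<circ> T))\<bar>"

context
  fixes T :: "real^'n::finite \<Rightarrow> 'a::euclidean_space"
  assumes lin: "linear T" and bij: "bij T"
begin

lemma linear_inv_coordinates: "linear (inv T)"
proof -
  have T: "T (inv T y) = y" "inv T (T x) = x" for x y
    using bij by (simp_all add: bij_is_inj bij_is_surj surj_f_inv_f)
  show ?thesis
  proof (rule linearI)
    show "inv T (x + y) = inv T x + inv T y" for x y
      using T(2)[of "inv T x + inv T y"] by (simp only: linear_add[OF lin] T(1))
    show "inv T (c *\<^sub>R x) = c *\<^sub>R inv T x" for c x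
      using T(2)[of "c *\<^sub>R inv T x"] by (simp only: linear_scale[OF lin] T(1))
  qed
qed

lemma linear_in_coordinates: "linear f \<Longrightarrow> linear (inv T \<circ> f \<circ> T)"
  using lin linear_inv_coordinates by (intro linear_compose)

lemma abs_det_wrt_compose:
  assumes "linear f" "linear g"
  shows "abs_det_wrt T (\<lambda>x. f (g x)) = abs_det_wrt T f * abs_det_wrt T g"
proof -
  have "inv T \<circ> (\<lambda>x. f (g x)) \<circ> T = (inv T \<circ> f \<circ> T) \<circ> (inv T \<circ> g \<circ> T)"
    using bij by (simp add: fun_eq_iff bij_is_surj surj_f_inv_f)
  then show ?thesis
    using assms unfolding abs_det_wrt_def
    by (simp add: matrix_compose linear_in_coordinates det_mul abs_mult)
qed

lemma abs_det_wrt_ident: "abs_det_wrt T (\<lambda>x. x) = 1"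
proof -
  have "inv T \<circ> (\<lambda>x. x) \<circ> T = id"
    using bij by (simp add: fun_eq_iff bij_is_inj)
  then show ?thesis
    by (simp add: abs_det_wrt_def)
qed

lemma abs_det_wrt_pos:
  assumes "linear f" "\<And>x. f x = 0 \<Longrightarrow> x = 0"
  shows "abs_det_wrt T f > 0"
proof -
  have "inj f"
    using assms by (simp add: linear_injective_0)
  then have "inj (inv T \<circ> f \<circ> T)"
    using bij by (intro inj_compose) (auto simp: bij_is_inj bij_imp_bij_inv)
  then show ?thesis
    using det_nz_iff_inj[OF linear_in_coordinates[OF assms(1)]] by (simp add: abs_det_wrt_def)
qed

lemma abs_det_wrt_entries:
  "abs_det_wrt T f =
    \<bar>\<Sum>p | p permutes UNIV. of_int (sign p) * (\<Prod>i\<in>UNIV. inv T (f (T (axis (p i) 1))) $ i)\<bar>"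
  by (simp add: abs_det_wrt_def det_def matrix_def)

lemma continuous_on_abs_det_wrt:
  fixes F :: "'b::topological_space \<Rightarrow> 'a \<Rightarrow> 'a"
  assumes "\<And>v. continuous_on S (\<lambda>x. F x v)"
  shows "continuous_on S (\<lambda>x. abs_det_wrt T (F x))"
proof -
  have "continuous_on UNIV (inv T)"
    using linear_inv_coordinates linear_conv_bounded_linear linear_continuous_on by blast
  then have "continuous_on S (\<lambda>x. inv T (F x v))" for v
    by (rule continuous_on_compose2) (use assms in auto)
  then show ?thesis
    unfolding abs_det_wrt_entries by (intro continuous_intros)
qed

end

lemma integral_change_of_variables_wrt:
  fixes T :: "real^'n::{finite,wellorder} \<Rightarrow> 'a::euclidean_space" and g :: "'a \<Rightarrow> 'a" and h :: "'a \<Rightarrow> real"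
  assumes T: "linear T" "bij T"
    and S [measurable]: "S \<in> sets borel"
    and der: "\<And>x. x \<in> S \<Longrightarrow> (g has_derivative g' x) (at x)"
    and inj: "inj_on g S"
    and meas: "(\<lambda>y. indicator (g ` S) y * h y) \<in> borel_measurable borel"
      "(\<lambda>x. indicator S x * (abs_det_wrt T (g' x) * h (g x))) \<in> borel_measurable borel"
  shows "(\<integral>y. indicator (g ` S) y * h y \<partial>distr lborel borel T)
    = (\<integral>x. indicator S x * (abs_det_wrt T (g' x) * h (g x)) \<partial>distr lborel borel T)"
proof -
  have T_meas [measurable]: "T \<in> borel_measurable borel"
    by (rule borel_measurable_linear) fact
  have TT: "inv T (T x) = x" "T (inv T y) = y" for x y
    using T by (simp_all add: bij_is_inj bij_is_surj surj_f_inv_f)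
  define k where "k = inv T \<circ> g \<circ> T"
  define k' where "k' = (\<lambda>x. inv T \<circ> g' (T x) \<circ> T)"
  have blT: "bounded_linear T" "bounded_linear (inv T)"
    using T linear_inv_coordinates linear_conv_bounded_linear by blast+
  have img: "k ` (T -` S) = T -` (g ` S)"
    unfolding k_def image_comp[symmetric] using T TT
    by (auto simp: bij_is_surj surj_image_vimage_eq image_iff) (metis TT)+
  have [simp]: "indicator (T -` A) x = (indicator A (T x) :: real)" for A x
    by (simp add: indicator_def)
  have Tk: "T (k x) = g (T x)" for x
    by (simp add: k_def TT)
  have der_k: "(k has_derivative k' x) (at x)" if "x \<in> T -` S" for x
  proof -
    have "(T has_derivative T) (at x)"
      using blT(1) by (rule bounded_linear_imp_has_derivative)
    moreover have "(g has_derivative g' (T x)) (at (T x))"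
      using that der by simp
    ultimately have "(g \<circ> T has_derivative g' (T x) \<circ> T) (at x)"
      by (rule diff_chain_at)
    from diff_chain_at[OF this bounded_linear_imp_has_derivative[OF blT(2)]]
    show ?thesis
      by (simp add: k_def k'_def o_assoc)
  qed
  have "(\<integral>y. indicator (g ` S) y * h y \<partial>distr lborel borel T)
      = (\<integral>y. indicator (k ` (T -` S)) y * h (T y) \<partial>lborel)"
    unfolding img by (subst integral_distr) (use meas in auto)
  also have "\<dots> = (\<integral>x. indicator (T -` S) x * (\<bar>det (matrix (k' x))\<bar> * h (T (k x))) \<partial>lborel)"
  proof (rule lborel_integral_change_of_variables[OF _ der_k])
    show "T -` S \<in> sets borel"
      using measurable_sets_borel[OF T_meas S] .
    show "inj_on k (T -` S)"
    proof (rule inj_onI)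
      fix x y assume "x \<in> T -` S" "y \<in> T -` S" "k x = k y"
      then have "T x = T y"
        using inj Tk by (metis inj_onD vimageD)
      then show "x = y"
        using TT(1) by metis
    qed
    show "(\<lambda>y. indicator (k ` (T -` S)) y * h (T y)) \<in> borel_measurable borel"
      using measurable_compose[OF T_meas meas(1)] by (simp add: img)
    show "(\<lambda>x. indicator (T -` S) x * (\<bar>det (matrix (k' x))\<bar> * h (T (k x)))) \<in> borel_measurable borel"
      using measurable_compose[OF T_meas meas(2)] by (simp add: Tk k'_def abs_det_wrt_def)
  qed
  also have "\<dots> = (\<integral>x. indicator S x * (abs_det_wrt T (g' x) * h (g x)) \<partial>distr lborel borel T)"
    by (subst integral_distr) (use meas in \<open>auto simp: Tk k'_def abs_det_wrt_def\<close>)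
  finally show ?thesis .
qed

section \<open>The matrix exponential and its derivative\<close>

lemma bounded_bilinear_matrix_mult:
  "bounded_bilinear ((**) :: real^'n^'m \<Rightarrow> real^'p^'n \<Rightarrow> real^'p^'m)"
  unfolding bilinear_conv_bounded_bilinear[symmetric] bilinear_def
  by (auto intro!: linearI simp: vec_eq_iff matrix_matrix_mult_def sum.distrib sum_distrib_left
      algebra_simps)

interpretation matrix_mult: bounded_bilinear "(**) :: real^'d^'d \<Rightarrow> real^'d^'d \<Rightarrow> real^'d^'d"
  by (rule bounded_bilinear_matrix_mult)

lemma linear_matrix_mult_left: "linear (\<lambda>X :: real^'d^'d. (A :: real^'d^'d) ** X)"
  by (rule bounded_linear.linear[OF matrix_mult.bounded_linear_right])

lemma matrix_power_0 [simp]: "matrix_power A 0 = mat 1"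
  and matrix_power_Suc [simp]: "matrix_power A (Suc k) = A ** matrix_power A k"
  by (simp_all add: matrix_power_def)

text \<open>The directional derivative of \<open>X \<mapsto> X ^ k\<close> in direction \<open>H\<close>, unfolded by the product rule.\<close>

primrec dmatrix_power :: "real^'d^'d \<Rightarrow> real^'d^'d \<Rightarrow> nat \<Rightarrow> real^'d^'d" where
  "dmatrix_power X H 0 = 0"
| "dmatrix_power X H (Suc k) = H ** matrix_power X k + X ** dmatrix_power X H k"

definition dmexp :: "real^'d^'d \<Rightarrow> real^'d^'d \<Rightarrow> real^'d^'d" where
  "dmexp X H = (\<Sum>k. (1 / fact k) *\<^sub>R dmatrix_power X H k)"

lemma has_derivative_matrix_power:
  "((\<lambda>X. matrix_power X k) has_derivative (\<lambda>H. dmatrix_power X H k)) (at X within S)"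
proof (induction k)
  case (Suc k)
  have "((\<lambda>X. X ** matrix_power X k) has_derivative
      (\<lambda>H. X ** dmatrix_power X H k + H ** matrix_power X k)) (at X within S)"
    by (rule matrix_mult.FDERIV[OF has_derivative_ident Suc])
  then show ?case
    by (simp add: add.commute)
qed simp

lemma summable_power_over_fact: "summable (\<lambda>k. (q::real) ^ k / fact k)"
  using summable_exp[of q] by (simp add: divide_inverse mult.commute)

text \<open>One summable sequence that dominates the exponential series and its termwise derivative on a whole ball.
Powers are estimated with a bound \<open>K\<close> for the bilinear matrix product, and the factor \<open>k\<close> that the
product rule creates is absorbed by \<open>2 ^ k\<close>.\<close>

lemma mexp_term_bounds:
  fixes R :: real
  assumes R: "0 \<le> R"
  obtains M :: "nat \<Rightarrow> real" where "summable M" "\<forall>k. 0 \<le> M k"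
    "\<forall>(X :: real^'d^'d) k. norm X \<le> R \<longrightarrow> norm ((1 / fact k) *\<^sub>R matrix_power X k) \<le> M k"
    "\<forall>(X :: real^'d^'d) H k. norm X \<le> R \<longrightarrow> norm ((1 / fact k) *\<^sub>R dmatrix_power X H k) \<le> M k * norm H"
proof -
  have "\<exists>K0>0. \<forall>(A :: real^'d^'d) B :: real^'d^'d. norm (A ** B) \<le> norm A * norm B * K0"
    by (rule matrix_mult.pos_bounded)
  then obtain K0 where K0: "0 < K0" "\<And>(A :: real^'d^'d) B :: real^'d^'d. norm (A ** B) \<le> norm A * norm B * K0"
    by auto
  define K where "K = max 1 (max K0 (norm (mat 1 :: real^'d^'d)))"
  have K: "1 \<le> K" "K0 \<le> K" "norm (mat 1 :: real^'d^'d) \<le> K"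
    by (auto simp: K_def)
  have nm: "norm (A ** B) \<le> K * norm A * norm B" for A B :: "real^'d^'d"
    using K0(2)[of A B] mult_left_mono[OF K(2), of "norm A * norm B"] by (simp add: mult_ac)
  \<comment> \<open>\<open>q \<ge> 1\<close> makes \<open>q ^ k\<close> increasing, so that both summands of the product rule have the same bound.\<close>
  define q where "q = max 1 (K * R)"
  have q: "1 \<le> q" "K * R \<le> q"
    by (auto simp: q_def)
  have KX: "K * norm X \<le> q" if "norm X \<le> R" for X :: "real^'d^'d"
    using mult_left_mono[OF that, of K] K q by linarith
  have pow: "norm (matrix_power X k) \<le> K * q ^ k" if "norm X \<le> R" for X :: "real^'d^'d" and k
  proof (induction k)
    case (Suc k)
    have "norm (matrix_power X (Suc k)) \<le> (K * norm X) * norm (matrix_power X k)"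
      using nm[of X "matrix_power X k"] by simp
    also have "\<dots> \<le> q * (K * q ^ k)"
      using Suc K q KX[OF that] by (intro mult_mono) auto
    finally show ?case by (simp add: mult_ac)
  qed (simp add: K)
  have dpow: "norm (dmatrix_power X H k) \<le> real k * (K\<^sup>2 * norm H * q ^ k)"
    if "norm X \<le> R" for X H :: "real^'d^'d" and k
  proof (induction k)
    case (Suc k)
    have "norm (H ** matrix_power X k) \<le> K * norm H * (K * q ^ k)"
      using nm[of H "matrix_power X k"] mult_left_mono[OF pow[OF that], of "K * norm H" k] K(1)
      by (meson mult_nonneg_nonneg norm_ge_zero order_trans zero_le_one)
    also have "\<dots> \<le> K\<^sup>2 * norm H * q ^ Suc k"
      using q K mult_right_mono[OF q(1), of "K\<^sup>2 * norm H * q ^ k"] by (simp add: power2_eq_square mult_ac)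
    finally have 1: "norm (H ** matrix_power X k) \<le> K\<^sup>2 * norm H * q ^ Suc k" .
    have "norm (X ** dmatrix_power X H k) \<le> (K * norm X) * norm (dmatrix_power X H k)"
      using nm by simp
    also have "\<dots> \<le> q * (real k * (K\<^sup>2 * norm H * q ^ k))"
      using Suc K q KX[OF that] by (intro mult_mono) auto
    finally have 2: "norm (X ** dmatrix_power X H k) \<le> real k * (K\<^sup>2 * norm H * q ^ Suc k)"
      by (simp add: mult_ac)
    have "norm (dmatrix_power X H (Suc k)) \<le> norm (H ** matrix_power X k) + norm (X ** dmatrix_power X H k)"
      by (simp add: norm_triangle_ineq)
    with 1 2 show ?case
      by (simp add: distrib_right)
  qed simp
  define M where "M = (\<lambda>k. K\<^sup>2 * ((2 * q) ^ k / fact k))"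
  have M1: "norm ((1 / fact k) *\<^sub>R matrix_power X k) \<le> M k" if "norm X \<le> R" for X :: "real^'d^'d" and k
  proof -
    have "K * q ^ k \<le> K\<^sup>2 * (2 * q) ^ k"
      using K q by (intro mult_mono power_mono) (auto simp: power2_eq_square)
    with pow[OF that, of k] show ?thesis
      by (simp add: M_def divide_right_mono)
  qed
  have M2: "norm ((1 / fact k) *\<^sub>R dmatrix_power X H k) \<le> M k * norm H" if "norm X \<le> R" for X H :: "real^'d^'d" and k
  proof -
    have "real k \<le> 2 ^ k"
      by (metis less_exp less_imp_le of_nat_le_iff of_nat_numeral of_nat_power)
    then have "real k * (K\<^sup>2 * norm H * q ^ k) \<le> 2 ^ k * (K\<^sup>2 * norm H * q ^ k)"
      using q by (intro mult_right_mono) auto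
    with dpow[OF that, of H k] have "norm (dmatrix_power X H k) \<le> K\<^sup>2 * (2 * q) ^ k * norm H"
      by (simp add: power_mult_distrib mult_ac)
    then show ?thesis
      by (simp add: M_def divide_right_mono)
  qed
  have "summable M"
    unfolding M_def by (intro summable_mult summable_power_over_fact)
  moreover have "\<forall>k. 0 \<le> M k"
    using q by (simp add: M_def)
  ultimately show ?thesis
    using that M1 M2 by blast
qed

lemma mexp_sums: "(\<lambda>k. (1 / fact k) *\<^sub>R matrix_power X k) sums mexp (X :: real^'d^'d)"
proof -
  obtain M where M: "summable M" "\<forall>k. 0 \<le> M k"
    "\<forall>(Y :: real^'d^'d) k. norm Y \<le> norm X \<longrightarrow> norm ((1 / fact k) *\<^sub>R matrix_power Y k) \<le> M k"
    "\<forall>(Y :: real^'d^'d) H k. norm Y \<le> norm X \<longrightarrow>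
      norm ((1 / fact k) *\<^sub>R dmatrix_power Y H k) \<le> M k * norm H"
    by (rule mexp_term_bounds[where 'd = 'd, OF norm_ge_zero[of X]])
  show ?thesis
    unfolding mexp_def by (intro summable_sums summable_comparison_test'[OF M(1)] M(3)[rule_format] order_refl)
qed

lemma dmexp_sums: "(\<lambda>k. (1 / fact k) *\<^sub>R dmatrix_power X H k) sums dmexp X (H :: real^'d^'d)"
proof -
  obtain M where M: "summable M" "\<forall>k. 0 \<le> M k"
    "\<forall>(Y :: real^'d^'d) k. norm Y \<le> norm X \<longrightarrow> norm ((1 / fact k) *\<^sub>R matrix_power Y k) \<le> M k"
    "\<forall>(Y :: real^'d^'d) H k. norm Y \<le> norm X \<longrightarrow>
      norm ((1 / fact k) *\<^sub>R dmatrix_power Y H k) \<le> M k * norm H"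
    by (rule mexp_term_bounds[where 'd = 'd, OF norm_ge_zero[of X]])
  show ?thesis
    unfolding dmexp_def
    by (intro summable_sums summable_comparison_test'[OF summable_mult2[OF M(1), of "norm H"]] M(4)[rule_format] order_refl)
qed

text \<open>Termwise differentiation: the tail of the differentiated series is bounded on a ball, uniformly in the base
point and linearly in the direction.\<close>

theorem has_derivative_mexp: "(mexp has_derivative dmexp X) (at (X :: real^'d^'d))"
proof -
  define S where "S = ball (0 :: real^'d^'d) (norm X + 1)"
  have "0 \<le> norm X + 1"
    by (simp add: add_nonneg_nonneg)
  then obtain M where M: "summable M" "\<forall>k. 0 \<le> M k"
    "\<forall>(Y :: real^'d^'d) k. norm Y \<le> norm X + 1 \<longrightarrow> norm ((1 / fact k) *\<^sub>R matrix_power Y k) \<le> M k"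
    "\<forall>(Y :: real^'d^'d) H k. norm Y \<le> norm X + 1 \<longrightarrow>
      norm ((1 / fact k) *\<^sub>R dmatrix_power Y H k) \<le> M k * norm H"
    by (rule mexp_term_bounds[where 'd = 'd])
  have "\<exists>g. \<forall>Y\<in>S. (\<lambda>k. (1 / fact k) *\<^sub>R matrix_power Y k) sums g Y \<and> (g has_derivative dmexp Y) (at Y within S)"
  proof (rule has_derivative_series)
    show "((\<lambda>Y. (1 / fact k) *\<^sub>R matrix_power Y k) has_derivative (\<lambda>H. (1 / fact k) *\<^sub>R dmatrix_power Y H k))
        (at Y within S)" for k Y
      by (intro has_derivative_scaleR_right has_derivative_matrix_power)
    show "\<forall>\<^sub>F n in sequentially. \<forall>Y\<in>S. \<forall>H.
        norm ((\<Sum>k<n. (1 / fact k) *\<^sub>R dmatrix_power Y H k) - dmexp Y H) \<le> e * norm H" if "0 < e" for e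
    proof -
      obtain N where N: "\<And>n. n \<ge> N \<Longrightarrow> norm (\<Sum>i. M (i + n)) < e"
        using suminf_exist_split[OF \<open>0 < e\<close> M(1)] by blast
      have "norm ((\<Sum>k<n. (1 / fact k) *\<^sub>R dmatrix_power Y H k) - dmexp Y H) \<le> e * norm H"
        if "n \<ge> N" "Y \<in> S" for n Y H
      proof -
        let ?f = "\<lambda>k. (1 / fact k) *\<^sub>R dmatrix_power Y H k"
        have f: "norm (?f k) \<le> M k * norm H" for k
          using M(4) that by (simp add: S_def less_imp_le)
        have summ: "summable (\<lambda>i. M (i + n) * norm H)"
          by (intro summable_mult2 summable_ignore_initial_segment M)
        have "norm ((\<Sum>k<n. ?f k) - dmexp Y H) = norm (\<Sum>i. ?f (i + n))"
          using suminf_minus_initial_segment[OF sums_summable[OF dmexp_sums[of Y H]], of n]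
          by (simp add: dmexp_def norm_minus_commute)
        also have "\<dots> \<le> (\<Sum>i. M (i + n) * norm H)"
          using f by (intro norm_suminf_le summ)
        also have "\<dots> = (\<Sum>i. M (i + n)) * norm H"
          using M by (simp add: suminf_mult2[symmetric] summable_ignore_initial_segment)
        also have "\<dots> \<le> e * norm H"
          using N[OF that(1)] by (intro mult_right_mono) auto
        finally show ?thesis .
      qed
      then show ?thesis
        by (auto simp: eventually_sequentially)
    qed
  qed (auto simp: S_def add_nonneg_pos intro: mexp_sums[of 0])
  then obtain g where g: "\<And>Y. Y \<in> S \<Longrightarrow> (\<lambda>k. (1 / fact k) *\<^sub>R matrix_power Y k) sums g Y"
    "\<And>Y. Y \<in> S \<Longrightarrow> (g has_derivative dmexp Y) (at Y within S)"
    by blast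
  have XS: "X \<in> S" "open S"
    by (simp_all add: S_def)
  have "g Y = mexp Y" if "Y \<in> S" for Y
    using g(1)[OF that] mexp_sums[of Y] by (rule sums_unique2)
  moreover have "(g has_derivative dmexp X) (at X)"
    using g(2)[OF XS(1)] at_within_open[OF XS] by simp
  ultimately show ?thesis
    using XS has_derivative_transform_within_open by blast
qed

lemma linear_dmexp: "linear (dmexp X)"
  by (rule has_derivative_linear[OF has_derivative_mexp])

lemma continuous_on_mexp [continuous_intros]:
  fixes f :: "'a::topological_space \<Rightarrow> real^'d^'d"
  shows "continuous_on S f \<Longrightarrow> continuous_on S (\<lambda>x. mexp (f x))"
proof -
  have "continuous_on UNIV (mexp :: real^'d^'d \<Rightarrow> _)"
    by (intro continuous_at_imp_continuous_on ballI has_derivative_continuous[OF has_derivative_mexp])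
  then show "continuous_on S f \<Longrightarrow> continuous_on S (\<lambda>x. mexp (f x))"
    by (rule continuous_on_compose2) auto
qed

lemma mexp_0 [simp]: "mexp (0 :: real^'d^'d) = mat 1"
proof -
  have "(\<lambda>k. (1 / fact k) *\<^sub>R matrix_power (0 :: real^'d^'d) k) = (\<lambda>k. if k = 0 then mat 1 else 0)"
    by (auto simp: fun_eq_iff matrix_mult.zero_left gr0_conv_Suc)
  with mexp_sums[of "0 :: real^'d^'d"] show ?thesis
    using sums_unique2[OF _ sums_single[of 0 "\<lambda>_. mat 1 :: real^'d^'d"]] by simp
qed

lemma dmexp_0 [simp]: "dmexp 0 H = (H :: real^'d^'d)"
proof -
  have "(1 / fact k) *\<^sub>R dmatrix_power 0 H k = (if k = 1 then H else 0)" for k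
  proof (cases k)
    case (Suc n)
    then show ?thesis
      by (cases n) (auto simp: matrix_mult.zero_left matrix_mult.zero_right)
  qed simp
  then have "(\<lambda>k. (1 / fact k) *\<^sub>R dmatrix_power 0 H k) sums H"
    using sums_single[of 1 "\<lambda>_. H"] by simp
  then show ?thesis
    by (rule sums_unique2[OF dmexp_sums])
qed

lemma matrix_power_commute:
  assumes "X ** Y = Y ** X"
  shows "X ** matrix_power Y k = matrix_power Y k ** (X :: real^'d^'d)"
proof (induction k)
  case (Suc k)
  have "X ** (Y ** matrix_power Y k) = Y ** (X ** matrix_power Y k)"
    using assms by (simp add: matrix_mul_assoc)
  also have "\<dots> = (Y ** matrix_power Y k) ** X"
    by (simp add: Suc matrix_mul_assoc)
  finally show ?case by simp
qed simp

lemma mexp_commute: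
  assumes "X ** Y = Y ** X"
  shows "X ** mexp Y = mexp Y ** (X :: real^'d^'d)"
proof -
  have "(\<lambda>k. X ** ((1 / fact k) *\<^sub>R matrix_power Y k)) sums (X ** mexp Y)"
    by (rule bounded_linear.sums[OF matrix_mult.bounded_linear_right mexp_sums])
  moreover have "(\<lambda>k. ((1 / fact k) *\<^sub>R matrix_power Y k) ** X) sums (mexp Y ** X)"
    by (rule bounded_linear.sums[OF matrix_mult.bounded_linear_left mexp_sums])
  ultimately show ?thesis
    unfolding matrix_mult.scaleR_left matrix_mult.scaleR_right matrix_power_commute[OF assms]
    by (rule sums_unique2)
qed

lemma dmexp_commute:
  assumes "X ** Y = Y ** X"
  shows "dmexp Y X = X ** mexp (Y :: real^'d^'d)"
proof -
  have d: "dmatrix_power Y X (Suc k) = real (Suc k) *\<^sub>R (X ** matrix_power Y k)" for k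
  proof (induction k)
    case (Suc k)
    let ?Z = "X ** matrix_power Y (Suc k)"
    have "Y ** (X ** matrix_power Y k) = ?Z"
      using assms by (simp add: matrix_mul_assoc)
    then have "dmatrix_power Y X (Suc (Suc k)) = ?Z + real (Suc k) *\<^sub>R ?Z"
      unfolding dmatrix_power.simps(2)[of Y X "Suc k"] Suc matrix_mult.scaleR_right by simp
    also have "\<dots> = (1 + real (Suc k)) *\<^sub>R ?Z"
      unfolding scaleR_left_distrib by simp
    finally show ?case by (simp only: of_nat_Suc)
  qed (simp add: matrix_mult.zero_right)
  have "(\<lambda>k. X ** ((1 / fact k) *\<^sub>R matrix_power Y k)) sums (X ** mexp Y)"
    by (rule bounded_linear.sums[OF matrix_mult.bounded_linear_right mexp_sums])
  moreover have "X ** ((1 / fact k) *\<^sub>R matrix_power Y k) = (1 / fact (Suc k)) *\<^sub>R dmatrix_power Y X (Suc k)" for k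
    unfolding d by (simp add: matrix_mult.scaleR_right del: of_nat_Suc)
  ultimately have "(\<lambda>k. (1 / fact (Suc k)) *\<^sub>R dmatrix_power Y X (Suc k)) sums (X ** mexp Y)"
    by simp
  then have "(\<lambda>k. (1 / fact k) *\<^sub>R dmatrix_power Y X k) sums (X ** mexp Y)"
    by (subst (asm) sums_Suc_iff) simp
  then show ?thesis
    by (rule sums_unique2[OF dmexp_sums])
qed

text \<open>The product \<open>t \<mapsto> exp (-t X) exp (t X)\<close> has derivative \<open>0\<close>, since \<open>X\<close> commutes with its exponentials.\<close>

theorem mexp_minus: "mexp (- X) ** mexp X = mat 1"
proof -
  define f where "f = (\<lambda>t::real. mexp (t *\<^sub>R (- X)) ** mexp (t *\<^sub>R X))"
  have der: "((\<lambda>t. mexp (t *\<^sub>R Z)) has_derivative (\<lambda>h. h *\<^sub>R (Z ** mexp (t *\<^sub>R Z)))) (at t)"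
    for t and Z :: "real^'d^'d"
  proof -
    have "((\<lambda>t. t *\<^sub>R Z) has_derivative (\<lambda>h. h *\<^sub>R Z)) (at t)"
      by (auto intro!: derivative_eq_intros)
    from diff_chain_at[OF this has_derivative_mexp]
    have "((\<lambda>t. mexp (t *\<^sub>R Z)) has_derivative (\<lambda>h. dmexp (t *\<^sub>R Z) (h *\<^sub>R Z))) (at t)"
      by (simp add: o_def)
    moreover have "dmexp (t *\<^sub>R Z) (h *\<^sub>R Z) = h *\<^sub>R (Z ** mexp (t *\<^sub>R Z))" for h
      using dmexp_commute[of Z "t *\<^sub>R Z"]
      by (simp add: linear_scale[OF linear_dmexp] matrix_mult.scaleR_left matrix_mult.scaleR_right)
    ultimately show ?thesis by simp
  qed
  have "(f has_derivative (\<lambda>h. 0)) (at t within UNIV)" for t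
  proof -
    have "X ** mexp (t *\<^sub>R - X) = mexp (t *\<^sub>R - X) ** X"
      by (rule mexp_commute) (simp add: matrix_mult.minus_left matrix_mult.minus_right
          matrix_mult.scaleR_left matrix_mult.scaleR_right)
    then have "mexp (t *\<^sub>R - X) ** (X ** mexp (t *\<^sub>R X)) = X ** mexp (t *\<^sub>R - X) ** mexp (t *\<^sub>R X)"
      by (simp add: matrix_mul_assoc)
    with matrix_mult.FDERIV[OF der[of "- X" t] der[of X t]] show ?thesis
      unfolding f_def by (simp add: matrix_mult.minus_left matrix_mult.scaleR_left matrix_mult.scaleR_right)
  qed
  then obtain c where c: "\<And>t. f t = c"
    using has_derivative_zero_constant[of UNIV f] by auto
  from c[of 0] c[of 1] show ?thesis
    by (simp add: f_def)
qed

section \<open>An algebra of absolutely convergent power series\<close>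

abbreviation multi_indices :: "'a set \<Rightarrow> ('a \<Rightarrow> nat) set" where
  "multi_indices B \<equiv> B \<rightarrow>\<^sub>E UNIV"

definition monomial_at :: "'a set \<Rightarrow> ('a \<Rightarrow> real) \<Rightarrow> ('a \<Rightarrow> nat) \<Rightarrow> real" where
  "monomial_at B t \<alpha> = (\<Prod>v\<in>B. t v ^ \<alpha> v)"

text \<open>\<open>f\<close> is the sum of a power series whose weighted \<open>\<ell>\<^sup>1\<close> norm on the cube of radius \<open>r\<close> is at
most \<open>M\<close>. Keeping the norm bound explicit makes this a Banach algebra in disguise, in which the
exponential series can be summed.\<close>

definition power_series_on :: "'a set \<Rightarrow> real \<Rightarrow> real \<Rightarrow> (('a \<Rightarrow> real) \<Rightarrow> real) \<Rightarrow> bool" where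
  "power_series_on B r M f \<longleftrightarrow>
    (\<exists>c N. ((\<lambda>\<alpha>. monomial_at B (\<lambda>_. r) \<alpha> * \<bar>c \<alpha>\<bar>) has_sum N) (multi_indices B) \<and> N \<le> M \<and>
      (\<forall>t. (\<forall>v\<in>B. \<bar>t v\<bar> \<le> r) \<longrightarrow> ((\<lambda>\<alpha>. monomial_at B t \<alpha> * c \<alpha>) has_sum f t) (multi_indices B)))"

lemma monomial_at_pos: "0 < r \<Longrightarrow> 0 < monomial_at B (\<lambda>_. r) \<alpha>"
  by (simp add: monomial_at_def prod_pos)

lemma monomial_at_le:
  assumes "\<And>v. v \<in> B \<Longrightarrow> \<bar>t v\<bar> \<le> r"
  shows "\<bar>monomial_at B t \<alpha>\<bar> \<le> monomial_at B (\<lambda>_. r) \<alpha>"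
  unfolding monomial_at_def abs_prod using assms by (intro prod_mono) (auto simp: power_abs power_mono)

lemma monomial_at_add:
  "monomial_at B t (\<lambda>v\<in>B. \<alpha> v + \<beta> v) = monomial_at B t \<alpha> * monomial_at B t \<beta>"
  by (simp add: monomial_at_def power_add prod.distrib)

lemma abs_has_sum_SigmaI:
  fixes f :: "'i \<times> 'j \<Rightarrow> real"
  assumes "\<And>x. x \<in> A \<Longrightarrow> ((\<lambda>y. \<bar>f (x, y)\<bar>) has_sum n x) (B x)" and "(n has_sum N) A"
  shows "((\<lambda>z. \<bar>f z\<bar>) has_sum N) (Sigma A B)"
proof (rule has_sum_SigmaI[OF assms])
  show "(\<lambda>z. \<bar>f z\<bar>) summable_on Sigma A B"
    by (rule summable_on_SigmaI[OF assms(1) has_sum_imp_summable[OF assms(2)]]) auto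
qed

lemma abs_has_sum_imp_summable:
  fixes f :: "'i \<Rightarrow> real"
  assumes "((\<lambda>x. \<bar>g x\<bar>) has_sum N) A" "\<And>x. x \<in> A \<Longrightarrow> \<bar>f x\<bar> \<le> \<bar>g x :: real\<bar>"
  shows "f summable_on A"
  by (rule abs_summable_summable, rule Infinite_Sum.abs_summable_on_comparison_test'[OF has_sum_imp_summable[OF assms(1)]])
    (simp add: assms(2))

text \<open>A family of monomials may be indexed arbitrarily and may repeat exponents; absolute convergence allows
collecting equal exponents. Constants, coordinates, products and infinite series become instances with a
convenient index set.\<close>

lemma power_series_on_regroup:
  fixes a :: "'i \<Rightarrow> real"
  assumes r: "0 < r"
    and e: "\<And>i. i \<in> I \<Longrightarrow> e i \<in> multi_indices B"
    and N: "((\<lambda>i. \<bar>monomial_at B (\<lambda>_. r) (e i) * a i\<bar>) has_sum N) I" "N \<le> M"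
    and f: "\<And>t. (\<And>v. v \<in> B \<Longrightarrow> \<bar>t v\<bar> \<le> r) \<Longrightarrow> ((\<lambda>i. monomial_at B t (e i) * a i) has_sum f t) I"
  shows "power_series_on B r M f"
proof -
  let ?E = "multi_indices B" and ?m = "monomial_at B (\<lambda>_. r)"
  \<comment> \<open>\<open>I\<close> is the disjoint union of the fibres of \<open>e\<close>, so every sum over \<open>I\<close> is an iterated sum.\<close>
  define F where "F = (\<lambda>\<alpha>. {i \<in> I. e i = \<alpha>})"
  define c where "c = (\<lambda>\<alpha>. infsum a (F \<alpha>))"
  have bij: "bij_betw snd (Sigma ?E F) I"
    by (rule bij_betw_byWitness[where f' = "\<lambda>i. (e i, i)"])
      ((auto simp: F_def)[3], simp add: F_def e image_subset_iff)
  have m: "0 < ?m \<alpha>" for \<alpha>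
    using r by (rule monomial_at_pos)
  have "(\<lambda>i. \<bar>?m (e i) * a i\<bar>) summable_on F \<alpha>" for \<alpha>
    using N(1) by (intro summable_on_subset_banach[OF has_sum_imp_summable]) (auto simp: F_def)
  then have "(\<lambda>i. ?m \<alpha> * \<bar>a i\<bar>) summable_on F \<alpha>" for \<alpha>
    by (rule summable_on_cong[THEN iffD1, rotated]) (auto simp: F_def abs_mult abs_of_pos[OF m])
  then have abs_a: "(\<lambda>i. \<bar>a i\<bar>) summable_on F \<alpha>" for \<alpha>
    using summable_on_cmult_right'[of "?m \<alpha>" "\<lambda>i. \<bar>a i\<bar>" "F \<alpha>"] m[of \<alpha>] by auto
  then have a: "(a has_sum c \<alpha>) (F \<alpha>)" for \<alpha>
    using abs_summable_summable[of a "F \<alpha>"] by (auto simp: c_def)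
  have sums: "((\<lambda>\<alpha>. monomial_at B t \<alpha> * c \<alpha>) has_sum f t) ?E" if "\<And>v. v \<in> B \<Longrightarrow> \<bar>t v\<bar> \<le> r" for t
  proof (rule has_sum_SigmaD)
    show "((\<lambda>z. monomial_at B t (e (snd z)) * a (snd z)) has_sum f t) (Sigma ?E F)"
      using f[OF that] by (subst has_sum_reindex_bij_betw[OF bij])
    show "((\<lambda>i. monomial_at B t (e (snd (\<alpha>, i))) * a (snd (\<alpha>, i))) has_sum monomial_at B t \<alpha> * c \<alpha>) (F \<alpha>)" for \<alpha>
      using has_sum_cmult_right[OF a, of "monomial_at B t \<alpha>" \<alpha>]
      by (rule has_sum_cong[THEN iffD1, rotated]) (auto simp: F_def)
  qed
  have bound: "((\<lambda>\<alpha>. ?m \<alpha> * infsum (\<lambda>i. \<bar>a i\<bar>) (F \<alpha>)) has_sum N) ?E"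
  proof (rule has_sum_SigmaD)
    show "((\<lambda>z. \<bar>?m (e (snd z)) * a (snd z)\<bar>) has_sum N) (Sigma ?E F)"
      using N(1) by (subst has_sum_reindex_bij_betw[OF bij])
    show "((\<lambda>i. \<bar>?m (e (snd (\<alpha>, i))) * a (snd (\<alpha>, i))\<bar>) has_sum ?m \<alpha> * infsum (\<lambda>i. \<bar>a i\<bar>) (F \<alpha>)) (F \<alpha>)" for \<alpha>
      using has_sum_cmult_right[OF has_sum_infsum[OF abs_a], of "?m \<alpha>" \<alpha>]
      by (rule has_sum_cong[THEN iffD1, rotated]) (auto simp: F_def abs_mult abs_of_pos[OF m])
  qed
  have le: "?m \<alpha> * \<bar>c \<alpha>\<bar> \<le> ?m \<alpha> * infsum (\<lambda>i. \<bar>a i\<bar>) (F \<alpha>)" for \<alpha>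
    using norm_infsum_bound[of a "F \<alpha>"] abs_a[of \<alpha>] m[of \<alpha>] by (simp add: c_def)
  have "(\<lambda>\<alpha>. ?m \<alpha> * \<bar>c \<alpha>\<bar>) summable_on ?E"
    by (rule summable_on_comparison_test[OF has_sum_imp_summable[OF bound]])
      (use le m in \<open>auto simp: less_imp_le\<close>)
  then obtain N' where N': "((\<lambda>\<alpha>. ?m \<alpha> * \<bar>c \<alpha>\<bar>) has_sum N') ?E"
    by (auto simp: summable_on_def)
  then have "N' \<le> N"
    using bound le by (rule has_sum_mono)
  with N' N(2) sums show ?thesis
    unfolding power_series_on_def by (intro exI[of _ c] exI[of _ N']) auto
qed

lemma power_series_on_const:
  assumes "0 < r" "\<bar>k\<bar> \<le> M"
  shows "power_series_on B r M (\<lambda>_. k)"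
proof (rule power_series_on_regroup[where I = "{()}" and e = "\<lambda>_. \<lambda>v\<in>B. 0" and a = "\<lambda>_. k" and N = "\<bar>k\<bar>"])
qed (use assms in \<open>auto intro!: has_sum_finiteI simp: monomial_at_def\<close>)

lemma power_series_on_coordinate:
  assumes "0 < r" "finite B" "w \<in> B" "r \<le> M"
  shows "power_series_on B r M (\<lambda>t. t w)"
proof (rule power_series_on_regroup[where I = "{()}" and e = "\<lambda>_. \<lambda>v\<in>B. if v = w then 1 else 0"
      and a = "\<lambda>_. 1" and N = r])
  have "monomial_at B t (\<lambda>v\<in>B. if v = w then 1 else 0) = t w" for t
    unfolding monomial_at_def using assms prod.delta[of B w "\<lambda>v. t v"]
    by (subst prod.cong[OF refl, of B _ "\<lambda>v. if v = w then t v else 1"]) auto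
  then show "((\<lambda>i. \<bar>monomial_at B (\<lambda>_. r) (\<lambda>v\<in>B. if v = w then 1 else 0) * 1\<bar>) has_sum r) {()}"
    "\<And>t. ((\<lambda>i. monomial_at B t (\<lambda>v\<in>B. if v = w then 1 else 0) * 1) has_sum t w) {()}"
    using assms by (auto intro!: has_sum_finiteI)
qed (use assms in auto)

lemma power_series_on_add:
  assumes "power_series_on B r M f" "power_series_on B r M' g" "0 < r"
  shows "power_series_on B r (M + M') (\<lambda>t. f t + g t)"
proof -
  let ?E = "multi_indices B" and ?m = "monomial_at B (\<lambda>_. r)"
  obtain c N where c: "((\<lambda>\<alpha>. ?m \<alpha> * \<bar>c \<alpha>\<bar>) has_sum N) ?E" "N \<le> M"
    "\<And>t. (\<forall>v\<in>B. \<bar>t v\<bar> \<le> r) \<Longrightarrow> ((\<lambda>\<alpha>. monomial_at B t \<alpha> * c \<alpha>) has_sum f t) ?E"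
    using assms(1) unfolding power_series_on_def by blast
  obtain d N' where d: "((\<lambda>\<alpha>. ?m \<alpha> * \<bar>d \<alpha>\<bar>) has_sum N') ?E" "N' \<le> M'"
    "\<And>t. (\<forall>v\<in>B. \<bar>t v\<bar> \<le> r) \<Longrightarrow> ((\<lambda>\<alpha>. monomial_at B t \<alpha> * d \<alpha>) has_sum g t) ?E"
    using assms(2) unfolding power_series_on_def by blast
  have m: "0 < ?m \<alpha>" for \<alpha>
    using assms(3) by (rule monomial_at_pos)
  have sum: "((\<lambda>\<alpha>. ?m \<alpha> * (\<bar>c \<alpha>\<bar> + \<bar>d \<alpha>\<bar>)) has_sum (N + N')) ?E"
    using has_sum_add[OF c(1) d(1)] by (simp add: distrib_left)
  have le: "?m \<alpha> * \<bar>c \<alpha> + d \<alpha>\<bar> \<le> ?m \<alpha> * (\<bar>c \<alpha>\<bar> + \<bar>d \<alpha>\<bar>)" for \<alpha>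
    using m[of \<alpha>] abs_triangle_ineq[of "c \<alpha>" "d \<alpha>"] by simp
  have "(\<lambda>\<alpha>. ?m \<alpha> * \<bar>c \<alpha> + d \<alpha>\<bar>) summable_on ?E"
    by (rule summable_on_comparison_test[OF has_sum_imp_summable[OF sum]])
      (use le m in \<open>auto simp: less_imp_le\<close>)
  then obtain K where K: "((\<lambda>\<alpha>. ?m \<alpha> * \<bar>c \<alpha> + d \<alpha>\<bar>) has_sum K) ?E"
    by (auto simp: summable_on_def)
  have "K \<le> N + N'"
    using K sum le by (rule has_sum_mono)
  moreover have "((\<lambda>\<alpha>. monomial_at B t \<alpha> * (c \<alpha> + d \<alpha>)) has_sum (f t + g t)) ?E" if "\<forall>v\<in>B. \<bar>t v\<bar> \<le> r" for t
    using has_sum_add[OF c(3)[OF that] d(3)[OF that]] by (simp add: distrib_left)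
  ultimately show ?thesis
    unfolding power_series_on_def using K c(2) d(2)
    by (intro exI[of _ "\<lambda>\<alpha>. c \<alpha> + d \<alpha>"] exI[of _ K]) auto
qed

text \<open>Cauchy product, indexed by pairs of multi-indices.\<close>

lemma power_series_on_mult:
  assumes "power_series_on B r M f" "power_series_on B r M' g" "0 < r"
  shows "power_series_on B r (M * M') (\<lambda>t. f t * g t)"
proof -
  let ?E = "multi_indices B" and ?m = "monomial_at B (\<lambda>_. r)"
  obtain c N where c: "((\<lambda>\<alpha>. ?m \<alpha> * \<bar>c \<alpha>\<bar>) has_sum N) ?E" "N \<le> M"
    "\<And>t. (\<forall>v\<in>B. \<bar>t v\<bar> \<le> r) \<Longrightarrow> ((\<lambda>\<alpha>. monomial_at B t \<alpha> * c \<alpha>) has_sum f t) ?E"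
    using assms(1) unfolding power_series_on_def by blast
  obtain d N' where d: "((\<lambda>\<alpha>. ?m \<alpha> * \<bar>d \<alpha>\<bar>) has_sum N') ?E" "N' \<le> M'"
    "\<And>t. (\<forall>v\<in>B. \<bar>t v\<bar> \<le> r) \<Longrightarrow> ((\<lambda>\<alpha>. monomial_at B t \<alpha> * d \<alpha>) has_sum g t) ?E"
    using assms(2) unfolding power_series_on_def by blast
  have m: "0 < ?m \<alpha>" for \<alpha>
    using assms(3) by (rule monomial_at_pos)
  have N0: "0 \<le> N" "0 \<le> N'"
    using has_sum_nonneg[OF c(1)] has_sum_nonneg[OF d(1)] m by (auto simp: less_imp_le)
  define e where "e = (\<lambda>(\<alpha>, \<beta>). \<lambda>v\<in>B. \<alpha> v + (\<beta> v :: nat))"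
  define a where "a = (\<lambda>(\<alpha>, \<beta>). c \<alpha> * d \<beta>)"
  have split: "monomial_at B t (e (\<alpha>, \<beta>)) * a (\<alpha>, \<beta>)
      = (monomial_at B t \<alpha> * c \<alpha>) * (monomial_at B t \<beta> * d \<beta>)" for t \<alpha> \<beta>
    by (simp add: e_def a_def monomial_at_add)
  have N: "((\<lambda>z. \<bar>?m (e z) * a z\<bar>) has_sum (N * N')) (?E \<times> ?E)"
  proof (rule abs_has_sum_SigmaI)
    show "((\<lambda>\<beta>. \<bar>?m (e (\<alpha>, \<beta>)) * a (\<alpha>, \<beta>)\<bar>) has_sum (?m \<alpha> * \<bar>c \<alpha>\<bar> * N')) ?E" for \<alpha>
      using has_sum_cmult_right[OF d(1), of "?m \<alpha> * \<bar>c \<alpha>\<bar>"] m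
      by (simp add: split abs_mult less_imp_le mult.assoc)
    show "((\<lambda>\<alpha>. ?m \<alpha> * \<bar>c \<alpha>\<bar> * N') has_sum (N * N')) ?E"
      by (rule has_sum_cmult_left[OF c(1)])
  qed
  show ?thesis
  proof (rule power_series_on_regroup[OF assms(3) _ N])
    show "e z \<in> ?E" if "z \<in> ?E \<times> ?E" for z
      by (auto simp: e_def split: prod.split)
    show "N * N' \<le> M * M'"
      using c(2) d(2) N0 by (intro mult_mono) auto
    fix t assume t: "\<And>v. v \<in> B \<Longrightarrow> \<bar>t v\<bar> \<le> r"
    show "((\<lambda>z. monomial_at B t (e z) * a z) has_sum (f t * g t)) (?E \<times> ?E)"
    proof (rule has_sum_SigmaI)
      show "((\<lambda>\<beta>. monomial_at B t (e (\<alpha>, \<beta>)) * a (\<alpha>, \<beta>)) has_sum (monomial_at B t \<alpha> * c \<alpha> * g t)) ?E" for \<alpha>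
        unfolding split by (rule has_sum_cmult_right[OF d(3)]) (use t in auto)
      show "((\<lambda>\<alpha>. monomial_at B t \<alpha> * c \<alpha> * g t) has_sum (f t * g t)) ?E"
        by (rule has_sum_cmult_left[OF c(3)]) (use t in auto)
      show "(\<lambda>z. monomial_at B t (e z) * a z) summable_on ?E \<times> ?E"
        by (rule abs_has_sum_imp_summable[OF N])
          (use monomial_at_le[of B t r] t m in \<open>auto simp: abs_mult less_imp_le intro!: mult_right_mono\<close>)
    qed
  qed
qed

text \<open>Normally convergent series of power series, indexed by pairs of a summation index and a multi-index.\<close>

lemma power_series_on_sums:
  assumes f: "\<And>k. power_series_on B r (M k) (f k)" and r: "0 < r"
    and M: "summable M" and s: "\<And>t. (\<And>v. v \<in> B \<Longrightarrow> \<bar>t v\<bar> \<le> r) \<Longrightarrow> (\<lambda>k. f k t) sums s t"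
  shows "power_series_on B r (suminf M) s"
proof -
  let ?E = "multi_indices B" and ?m = "monomial_at B (\<lambda>_. r)"
  let ?P = "\<lambda>k c N. ((\<lambda>\<alpha>. ?m \<alpha> * \<bar>c \<alpha>\<bar>) has_sum N) ?E \<and> N \<le> M k \<and>
      (\<forall>t. (\<forall>v\<in>B. \<bar>t v\<bar> \<le> r) \<longrightarrow> ((\<lambda>\<alpha>. monomial_at B t \<alpha> * c \<alpha>) has_sum f k t) ?E)"
  have "\<forall>k. \<exists>c. \<exists>N. ?P k c N"
    using f unfolding power_series_on_def by blast
  from choice[OF this] obtain c where "\<forall>k. \<exists>N. ?P k (c k) N" ..
  from choice[OF this] obtain N where P: "\<forall>k. ?P k (c k) (N k)" ..
  have c: "((\<lambda>\<alpha>. ?m \<alpha> * \<bar>c k \<alpha>\<bar>) has_sum N k) ?E" "N k \<le> M k"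
    "(\<forall>v\<in>B. \<bar>t v\<bar> \<le> r) \<Longrightarrow> ((\<lambda>\<alpha>. monomial_at B t \<alpha> * c k \<alpha>) has_sum f k t) ?E" for k t
    using P[rule_format, of k] by simp_all
  have m: "0 < ?m \<alpha>" for \<alpha>
    using r by (rule monomial_at_pos)
  have N0: "0 \<le> N k" for k
    using has_sum_nonneg[OF c(1)] m by (auto simp: less_imp_le)
  have sumN: "summable N"
    by (rule summable_comparison_test'[OF M]) (use c(2) N0 in auto)
  define a where "a = (\<lambda>z :: nat \<times> ('a \<Rightarrow> nat). c (fst z) (snd z))"
  have N: "((\<lambda>z. \<bar>?m (snd z) * a z\<bar>) has_sum suminf N) (UNIV \<times> ?E)"
  proof (rule abs_has_sum_SigmaI)
    show "((\<lambda>\<alpha>. \<bar>?m (snd (k, \<alpha>)) * a (k, \<alpha>)\<bar>) has_sum N k) ?E" for k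
      using c(1)[of k] m by (simp add: a_def abs_mult less_imp_le)
    show "(N has_sum suminf N) UNIV"
      using sumN N0 by (intro sums_nonneg_imp_has_sum) (auto simp: summable_sums)
  qed
  show ?thesis
  proof (rule power_series_on_regroup[OF r _ N])
    show "suminf N \<le> suminf M"
      using c(2) sumN M by (rule suminf_le)
    fix t assume t: "\<And>v. v \<in> B \<Longrightarrow> \<bar>t v\<bar> \<le> r"
    have "(\<lambda>z. monomial_at B t (snd z) * a z) summable_on UNIV \<times> ?E"
      by (rule abs_has_sum_imp_summable[OF N])
        (use monomial_at_le[of B t r] t m in \<open>auto simp: abs_mult less_imp_le intro!: mult_right_mono\<close>)
    then obtain S where S: "((\<lambda>z. monomial_at B t (snd z) * a z) has_sum S) (UNIV \<times> ?E)"
      by (auto simp: summable_on_def)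
    have "((\<lambda>k. f k t) has_sum S) UNIV"
      by (rule has_sum_SigmaD[OF S]) (use c(3) t in \<open>auto simp: a_def\<close>)
    then have "S = s t"
      by (rule sums_unique2[OF has_sum_imp_sums s[OF t]])
    with S show "((\<lambda>z. monomial_at B t (snd z) * a z) has_sum s t) (UNIV \<times> ?E)"
      by simp
  qed auto
qed

lemma power_series_on_mono: "power_series_on B r M f \<Longrightarrow> M \<le> M' \<Longrightarrow> power_series_on B r M' f"
  unfolding power_series_on_def by (meson order_trans)

text \<open>A factor \<open>\<rho> / r \<le> 1\<close> appears once for each coordinate counted by the exponent; a non-constant monomial
contains at least one of them.\<close>

lemma monomial_at_shrink:
  assumes "finite B" "\<alpha> \<in> multi_indices B" "\<alpha> \<noteq> (\<lambda>v\<in>B. 0)" "0 < r" "0 \<le> \<rho>" "\<rho> \<le> r"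
    and "\<And>v. v \<in> B \<Longrightarrow> \<bar>t v\<bar> \<le> \<rho>"
  shows "\<bar>monomial_at B t \<alpha>\<bar> \<le> (\<rho> / r) * monomial_at B (\<lambda>_. r) \<alpha>"
proof -
  obtain w where w: "w \<in> B" "\<alpha> w \<noteq> 0"
    using assms(2,3) by (auto simp: fun_eq_iff PiE_iff extensional_def restrict_def split: if_splits)
  have le1: "(\<rho> / r) ^ \<alpha> v \<le> 1" for v
    using assms by (intro power_le_one) auto
  have "(\<Prod>v\<in>B. (\<rho> / r) ^ \<alpha> v) = (\<rho> / r) ^ \<alpha> w * (\<Prod>v\<in>B - {w}. (\<rho> / r) ^ \<alpha> v)"
    using w assms(1) by (simp add: prod.remove)
  also have "\<dots> \<le> (\<rho> / r) ^ \<alpha> w * 1"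
    using assms le1 by (intro mult_left_mono prod_le_1) auto
  also have "\<dots> \<le> \<rho> / r"
    using w assms power_decreasing[of 1 "\<alpha> w" "\<rho> / r"] by simp
  finally have le: "(\<Prod>v\<in>B. (\<rho> / r) ^ \<alpha> v) \<le> \<rho> / r" .
  have "\<bar>monomial_at B t \<alpha>\<bar> \<le> monomial_at B (\<lambda>_. \<rho>) \<alpha>"
    using assms(7) by (rule monomial_at_le)
  also have "\<dots> = (\<Prod>v\<in>B. (\<rho> / r) ^ \<alpha> v) * monomial_at B (\<lambda>_. r) \<alpha>"
    using monomial_at_pos[OF assms(4), of B \<alpha>] by (simp add: monomial_at_def power_divide prod_dividef)
  also have "\<dots> \<le> (\<rho> / r) * monomial_at B (\<lambda>_. r) \<alpha>"
    by (intro mult_right_mono le less_imp_le[OF monomial_at_pos[OF assms(4)]])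
  finally show ?thesis .
qed

text \<open>Every monomial other than the constant one shrinks at least by the factor \<open>\<rho> / r\<close> when the cube of
radius \<open>r\<close> is replaced by that of radius \<open>\<rho>\<close>.\<close>

lemma power_series_on_lipschitz_at_0:
  assumes "power_series_on B r M f" "finite B" "0 < r" "0 \<le> \<rho>" "\<rho> \<le> r"
    and t: "\<And>v. v \<in> B \<Longrightarrow> \<bar>t v\<bar> \<le> \<rho>"
  shows "\<bar>f t - f (\<lambda>_. 0)\<bar> \<le> M / r * \<rho>"
proof -
  let ?E = "multi_indices B" and ?m = "monomial_at B (\<lambda>_. r)"
  obtain c N where c: "((\<lambda>\<alpha>. ?m \<alpha> * \<bar>c \<alpha>\<bar>) has_sum N) ?E" "N \<le> M"
    "\<And>t. (\<forall>v\<in>B. \<bar>t v\<bar> \<le> r) \<Longrightarrow> ((\<lambda>\<alpha>. monomial_at B t \<alpha> * c \<alpha>) has_sum f t) ?E"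
    using assms(1) unfolding power_series_on_def by blast
  let ?d = "\<lambda>\<alpha>. monomial_at B t \<alpha> * c \<alpha> - monomial_at B (\<lambda>_. 0) \<alpha> * c \<alpha>"
  have d: "(?d has_sum (f t - f (\<lambda>_. 0))) ?E"
  proof -
    have "\<forall>v\<in>B. \<bar>t v\<bar> \<le> r" "\<forall>v\<in>B. \<bar>(0::real)\<bar> \<le> r"
      using t assms(3,5) by (auto intro: order_trans)
    from has_sum_add[OF c(3)[OF this(1)] has_sum_uminusI[OF c(3)[OF this(2)]]] show ?thesis
      by simp
  qed
  have le: "\<bar>?d \<alpha>\<bar> \<le> \<rho> / r * (?m \<alpha> * \<bar>c \<alpha>\<bar>)" if \<alpha>: "\<alpha> \<in> ?E" for \<alpha>
  proof (cases "\<alpha> = (\<lambda>v\<in>B. 0)")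
    case True
    then have "?d \<alpha> = 0"
      by (simp add: monomial_at_def)
    moreover have "0 \<le> \<rho> / r * (?m \<alpha> * \<bar>c \<alpha>\<bar>)"
      using assms monomial_at_pos[of r B \<alpha>] by simp
    ultimately show ?thesis
      by (simp only: abs_zero)
  next
    case False
    then obtain w where "w \<in> B" "\<alpha> w \<noteq> 0"
      using \<alpha> by (auto simp: fun_eq_iff PiE_iff extensional_def restrict_def split: if_splits)
    then have "monomial_at B (\<lambda>_. 0) \<alpha> = 0"
      using assms(2) by (auto simp: monomial_at_def prod_zero_iff)
    moreover have "\<bar>monomial_at B t \<alpha>\<bar> * \<bar>c \<alpha>\<bar> \<le> (\<rho> / r * ?m \<alpha>) * \<bar>c \<alpha>\<bar>"
      by (intro mult_right_mono monomial_at_shrink assms \<alpha> False) auto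
    ultimately show ?thesis
      by (simp add: abs_mult mult.assoc)
  qed
  have sum: "((\<lambda>\<alpha>. \<rho> / r * (?m \<alpha> * \<bar>c \<alpha>\<bar>)) has_sum (\<rho> / r * N)) ?E"
    by (rule has_sum_cmult_right[OF c(1)])
  have "\<bar>f t - f (\<lambda>_. 0)\<bar> \<le> \<rho> / r * N"
  proof -
    have "f t - f (\<lambda>_. 0) \<le> \<rho> / r * N"
      using d sum by (rule has_sum_mono) (use le in fastforce)
    moreover have "- (f t - f (\<lambda>_. 0)) \<le> \<rho> / r * N"
      using has_sum_uminusI[OF d] sum by (rule has_sum_mono) (use le in fastforce)
    ultimately show ?thesis by simp
  qed
  also have "\<dots> \<le> M / r * \<rho>"
    using c(2) assms mult_left_mono[of N M "\<rho> / r"] by (simp add: field_simps)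
  finally show ?thesis .
qed

definition has_power_series :: "'a set \<Rightarrow> real \<Rightarrow> (('a \<Rightarrow> real) \<Rightarrow> real) \<Rightarrow> bool" where
  "has_power_series B r f \<longleftrightarrow> (\<exists>M. power_series_on B r M f)"

lemma power_series_on_bound_nonneg:
  assumes "power_series_on B r M f" "0 < r"
  shows "0 \<le> M"
proof -
  obtain c N where c: "((\<lambda>\<alpha>. monomial_at B (\<lambda>_. r) \<alpha> * \<bar>c \<alpha>\<bar>) has_sum N) (multi_indices B)" "N \<le> M"
    using assms(1) unfolding power_series_on_def by blast
  have "0 \<le> N"
    by (rule has_sum_nonneg[OF c(1)]) (use monomial_at_pos[OF assms(2), of B] in \<open>auto simp: less_imp_le\<close>)
  with c(2) show ?thesis by simp
qed

lemma power_series_on_sum: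
  assumes "finite I" "\<And>i. i \<in> I \<Longrightarrow> power_series_on B r (M i) (f i)" "0 < r"
  shows "power_series_on B r (\<Sum>i\<in>I. M i) (\<lambda>t. \<Sum>i\<in>I. f i t)"
  using assms
  by (induction I rule: finite_induct) (auto intro!: power_series_on_add power_series_on_const)

lemma has_power_series_const: "0 < r \<Longrightarrow> has_power_series B r (\<lambda>_. k)"
  unfolding has_power_series_def using power_series_on_const by blast

lemma has_power_series_mult:
  "0 < r \<Longrightarrow> has_power_series B r f \<Longrightarrow> has_power_series B r g \<Longrightarrow> has_power_series B r (\<lambda>t. f t * g t)"
  unfolding has_power_series_def using power_series_on_mult by blast

lemma has_power_series_add:
  "0 < r \<Longrightarrow> has_power_series B r f \<Longrightarrow> has_power_series B r g \<Longrightarrow> has_power_series B r (\<lambda>t. f t + g t)"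
  unfolding has_power_series_def using power_series_on_add by blast

lemma has_power_series_sum:
  assumes "0 < r" "\<And>i. i \<in> I \<Longrightarrow> has_power_series B r (f i)"
  shows "has_power_series B r (\<lambda>t. \<Sum>i\<in>I. f i t)"
  using assms(2)
  by (induction I rule: infinite_finite_induct)
    (auto intro!: has_power_series_add has_power_series_const assms(1))

lemma has_power_series_prod:
  assumes "0 < r" "\<And>i. i \<in> I \<Longrightarrow> has_power_series B r (f i)"
  shows "has_power_series B r (\<lambda>t. \<Prod>i\<in>I. f i t)"
  using assms(2)
  by (induction I rule: infinite_finite_induct)
    (auto intro!: has_power_series_mult has_power_series_const assms(1))

lemma has_power_series_affine:
  fixes a :: "'a::real_vector" and l :: "'a \<Rightarrow> real"
  assumes "finite B" "0 < r" "linear l"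
  shows "has_power_series B r (\<lambda>t. l (a + (\<Sum>v\<in>B. t v *\<^sub>R v)))"
proof -
  have coord: "has_power_series B r (\<lambda>t. t v)" if "v \<in> B" for v
    unfolding has_power_series_def using power_series_on_coordinate[OF assms(2,1) that order_refl] by blast
  have "has_power_series B r (\<lambda>t. l a + (\<Sum>v\<in>B. t v * l v))"
    by (intro has_power_series_add has_power_series_sum has_power_series_mult has_power_series_const coord assms)
  then show ?thesis
    by (simp add: linear_add[OF assms(3)] linear_sum[OF assms(3)] linear_scale[OF assms(3)])
qed

context
  fixes B :: "'a set" and r :: real and X :: "('a \<Rightarrow> real) \<Rightarrow> real^'d^'d"
  assumes r: "0 < r" and X: "\<And>i j. has_power_series B r (\<lambda>t. X t $ i $ j)"
begin

text \<open>A common bound for the finitely many entries of \<open>X\<close> and of a fixed direction \<open>H\<close>.\<close>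

lemma matrix_entries_bound:
  fixes H :: "real^'d^'d"
  obtains M where "\<forall>i j. power_series_on B r M (\<lambda>t. X t $ i $ j)" "\<forall>i j. \<bar>H $ i $ j\<bar> \<le> M"
proof -
  obtain m where m: "\<And>i j. power_series_on B r (m i j) (\<lambda>t. X t $ i $ j)"
    using X unfolding has_power_series_def by metis
  define M where "M = (\<Sum>i\<in>UNIV. \<Sum>j\<in>UNIV. m i j + \<bar>H $ i $ j\<bar>)"
  have m0: "0 \<le> m i j" for i j
    using power_series_on_bound_nonneg[OF m r] .
  have le: "m i j + \<bar>H $ i $ j\<bar> \<le> M" for i j
  proof -
    have "m i j + \<bar>H $ i $ j\<bar> \<le> (\<Sum>j\<in>UNIV. m i j + \<bar>H $ i $ j\<bar>)"
      using m0 by (intro member_le_sum) auto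
    also have "\<dots> \<le> M"
      unfolding M_def using m0 by (intro member_le_sum[of i UNIV "\<lambda>i. \<Sum>j\<in>UNIV. m i j + \<bar>H $ i $ j\<bar>"] sum_nonneg) auto
    finally show ?thesis .
  qed
  show ?thesis
  proof (rule that)
    have "m i j \<le> M" "\<bar>H $ i $ j\<bar> \<le> M" for i j
      using le[of i j] m0[of i j] by linarith+
    then show "\<forall>i j. power_series_on B r M (\<lambda>t. X t $ i $ j)" "\<forall>i j. \<bar>H $ i $ j\<bar> \<le> M"
      using power_series_on_mono[OF m] by auto
  qed
qed

lemma power_series_on_matrix_product:
  fixes Y Z :: "('a \<Rightarrow> real) \<Rightarrow> real^'d^'d"
  assumes "\<And>i j. power_series_on B r M (\<lambda>t. Y t $ i $ j)" "\<And>i j. power_series_on B r M' (\<lambda>t. Z t $ i $ j)"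
  shows "power_series_on B r (real CARD('d) * M * M') (\<lambda>t. (Y t ** Z t) $ i $ j)"
proof -
  have "power_series_on B r (\<Sum>k\<in>(UNIV :: 'd set). M * M') (\<lambda>t. \<Sum>k\<in>UNIV. Y t $ i $ k * Z t $ k $ j)"
    by (intro power_series_on_sum power_series_on_mult assms r) auto
  then show ?thesis
    by (simp add: matrix_matrix_mult_def mult.assoc)
qed

text \<open>With entries of norm at most \<open>M\<close>, each matrix multiplication costs a factor \<open>CARD('d) * M\<close>.\<close>

lemma power_series_on_matrix_power:
  assumes M: "\<And>i j. power_series_on B r M (\<lambda>t. X t $ i $ j)"
  shows "power_series_on B r ((real CARD('d) * M) ^ k) (\<lambda>t. matrix_power (X t) k $ i $ j)"
proof (induction k arbitrary: i j)
  case 0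
  show ?case
    by (cases "i = j") (auto simp: mat_def intro!: power_series_on_const r)
next
  case (Suc k)
  show ?case
    using power_series_on_matrix_product[OF M Suc] by simp
qed

lemma power_series_on_dmatrix_power:
  assumes M: "\<And>i j. power_series_on B r M (\<lambda>t. X t $ i $ j)" and H: "\<And>i j. \<bar>H $ i $ j\<bar> \<le> M"
  shows "power_series_on B r (real k * (real CARD('d) * M) ^ k) (\<lambda>t. dmatrix_power (X t) H k $ i $ j)"
proof (induction k arbitrary: i j)
  case 0
  show ?case
    by simp (intro power_series_on_const r, simp)
next
  case (Suc k)
  let ?q = "real CARD('d) * M"
  have "power_series_on B r (?q * ?q ^ k + ?q * (real k * ?q ^ k))
      (\<lambda>t. (H ** matrix_power (X t) k) $ i $ j + (X t ** dmatrix_power (X t) H k) $ i $ j)"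
    by (intro power_series_on_add power_series_on_matrix_product power_series_on_matrix_power
        power_series_on_const M H Suc r)
  then show ?case
    by (simp add: algebra_simps)
qed

lemma has_power_series_exp_series:
  fixes f :: "nat \<Rightarrow> ('a \<Rightarrow> real) \<Rightarrow> real^'d^'d"
  assumes "\<And>k. power_series_on B r (N k) (\<lambda>t. f k t $ i $ j)" "summable (\<lambda>k. N k / fact k)"
    and "\<And>t. (\<lambda>k. (1 / fact k) *\<^sub>R f k t) sums s t"
  shows "has_power_series B r (\<lambda>t. s t $ i $ j)"
  unfolding has_power_series_def
proof (rule exI, rule power_series_on_sums[OF _ r assms(2)])
  show "power_series_on B r (N k / fact k) (\<lambda>t. 1 / fact k * f k t $ i $ j)" for k
    using power_series_on_mult[OF power_series_on_const[OF r order_refl] assms(1) r, of "1 / fact k" k] by simp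
  show "(\<lambda>k. 1 / fact k * f k t $ i $ j) sums (s t $ i $ j)" for t
    using bounded_linear.sums[OF bounded_linear_compose[OF bounded_linear_vec_nth bounded_linear_vec_nth]
        assms(3), of t i j] by simp
qed

lemma has_power_series_mexp: "has_power_series B r (\<lambda>t. mexp (X t) $ i $ j)"
proof -
  obtain M where M: "\<forall>i j. power_series_on B r M (\<lambda>t. X t $ i $ j)" "\<forall>i j. \<bar>(0 :: real^'d^'d) $ i $ j\<bar> \<le> M"
    by (rule matrix_entries_bound)
  show ?thesis
    by (rule has_power_series_exp_series[OF power_series_on_matrix_power[OF M(1)[rule_format]]
          summable_power_over_fact mexp_sums])
qed

lemma has_power_series_dmexp: "has_power_series B r (\<lambda>t. dmexp (X t) H $ i $ j)"
proof -
  obtain M where M: "\<forall>i j. power_series_on B r M (\<lambda>t. X t $ i $ j)" "\<forall>i j. \<bar>H $ i $ j\<bar> \<le> M"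
    by (rule matrix_entries_bound)
  let ?q = "real CARD('d) * M"
  have M0: "0 \<le> M"
    using M(2) by (meson abs_ge_zero order_trans)
  have "summable (\<lambda>k. real k * ?q ^ k / fact k)"
  proof (rule summable_comparison_test'[OF summable_power_over_fact[of "2 * ?q"]])
    fix k :: nat
    have "real k * ?q ^ k \<le> 2 ^ k * ?q ^ k"
      using M0 by (intro mult_right_mono) (auto simp: less_imp_le of_nat_less_two_power)
    then show "norm (real k * ?q ^ k / fact k) \<le> (2 * ?q) ^ k / fact k"
      using M0 by (simp add: power_mult_distrib divide_right_mono abs_mult)
  qed
  then show ?thesis
    by (rule has_power_series_exp_series[OF power_series_on_dmatrix_power[OF M(1)[rule_format] M(2)[rule_format]] _ dmexp_sums])
qed

end

lemma has_power_series_matrix_product: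
  fixes Y Z :: "('a \<Rightarrow> real) \<Rightarrow> real^'d^'d"
  assumes "0 < r" "\<And>i j. has_power_series B r (\<lambda>t. Y t $ i $ j)" "\<And>i j. has_power_series B r (\<lambda>t. Z t $ i $ j)"
  shows "has_power_series B r (\<lambda>t. (Y t ** Z t) $ i $ j)"
  unfolding matrix_matrix_mult_def by (simp, intro has_power_series_sum has_power_series_mult assms)

lemma has_power_series_linear_functional:
  fixes Y :: "('a \<Rightarrow> real) \<Rightarrow> real^'d^'d" and l :: "real^'d^'d \<Rightarrow> real"
  assumes "0 < r" "\<And>i j. has_power_series B r (\<lambda>t. Y t $ i $ j)" "linear l"
  shows "has_power_series B r (\<lambda>t. l (Y t))"
proof -
  have "has_power_series B r (\<lambda>t. Y t \<bullet> b)" if b: "b \<in> Basis" for b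
  proof -
    obtain i j where "b = axis i (axis j 1)"
      using b by (auto simp: Basis_vec_def)
    then show ?thesis
      using assms(2) by (simp add: inner_axis)
  qed
  then have "has_power_series B r (\<lambda>t. \<Sum>b\<in>Basis. (Y t \<bullet> b) * l b)"
    by (intro has_power_series_sum has_power_series_mult has_power_series_const assms)
  moreover have "(\<Sum>b\<in>Basis. (Y t \<bullet> b) * l b) = l (Y t)" for t
    using linear_sum[OF assms(3), of "\<lambda>b. (Y t \<bullet> b) *\<^sub>R b" Basis]
    by (simp add: linear_scale[OF assms(3)] euclidean_representation)
  ultimately show ?thesis by simp
qed

text \<open>The determinant is a polynomial in power series. On a cube on which it stays closer than
\<open>\<bar>d a\<bar>\<close> to its value \<open>d a\<close> at the centre it keeps its sign, so its absolute value is again a power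
series there.\<close>

lemma real_analytic_on_abs_det_wrt:
  fixes T :: "real^'n::finite \<Rightarrow> real^'d^'d" and F :: "real^'d^'d \<Rightarrow> real^'d^'d \<Rightarrow> real^'d^'d"
  assumes T: "linear T" "bij T" and "finite B"
    and cube: "\<And>a. a \<in> S \<Longrightarrow> \<exists>r>0. \<forall>t. (\<forall>v\<in>B. \<bar>t v\<bar> < r) \<longrightarrow> a + (\<Sum>v\<in>B. t v *\<^sub>R v) \<in> S"
    and F: "\<And>a r v i j. 0 < r \<Longrightarrow> has_power_series B r (\<lambda>t. F (a + (\<Sum>v\<in>B. t v *\<^sub>R v)) v $ i $ j)"
    and nz: "\<And>x. x \<in> S \<Longrightarrow> abs_det_wrt T (F x) \<noteq> 0"
  shows "real_analytic_on B (\<lambda>x. \<kappa> * abs_det_wrt T (F x)) S"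
  unfolding real_analytic_on_def
proof
  fix a assume a: "a \<in> S"
  let ?x = "\<lambda>t. a + (\<Sum>v\<in>B. t v *\<^sub>R v)"
  define d where "d = (\<lambda>x. \<Sum>p | p permutes (UNIV :: 'n set). of_int (sign p) *
    (\<Prod>i\<in>UNIV. inv T (F x (T (axis (p i) 1))) $ i))"
  have det: "abs_det_wrt T (F x) = \<bar>d x\<bar>" for x
    unfolding d_def by (rule abs_det_wrt_entries[OF T])
  have lin: "linear (\<lambda>A. inv T A $ i)" for i
    using linear_compose[OF linear_inv_coordinates[OF T] bounded_linear.linear[OF bounded_linear_vec_nth[of i]]]
    by (simp add: o_def)
  have ps: "has_power_series B r (\<lambda>t. d (?x t))" if "0 < r" for r
    unfolding d_def
    by (intro has_power_series_sum has_power_series_mult has_power_series_prod has_power_series_const that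
        has_power_series_linear_functional[OF that _ lin] F)
  obtain M where M: "power_series_on B 1 M (\<lambda>t. d (?x t))"
    using ps[of 1] by (auto simp: has_power_series_def)
  have M0: "0 \<le> M"
    using power_series_on_bound_nonneg[OF M] by simp
  obtain r0 where r0: "0 < r0" "\<And>t. (\<forall>v\<in>B. \<bar>t v\<bar> < r0) \<Longrightarrow> ?x t \<in> S"
    using cube[OF a] by blast
  have da: "d a \<noteq> 0"
    using nz[OF a] det by simp
  \<comment> \<open>With this radius the variation \<open>M * r\<close> of \<open>d\<close> on the cube is at most \<open>\<bar>d a\<bar> / 2\<close>.\<close>
  define r where "r = min (min 1 r0) (\<bar>d a\<bar> / (2 * (M + 1)))"
  have r: "0 < r" "r \<le> 1" "r \<le> r0" "r \<le> \<bar>d a\<bar> / (2 * (M + 1))"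
    using da M0 r0 by (auto simp: r_def)
  have close: "\<bar>d (?x t)\<bar> = sgn (d a) * d (?x t)" if t: "\<forall>v\<in>B. \<bar>t v\<bar> \<le> r" for t
  proof -
    have "\<bar>d (?x t) - d a\<bar> \<le> M * r"
      using power_series_on_lipschitz_at_0[OF M \<open>finite B\<close>, of r t] r t by simp
    also have "\<dots> \<le> (M + 1) * (\<bar>d a\<bar> / (2 * (M + 1)))"
      using M0 r by (intro mult_mono) auto
    also have "\<dots> = \<bar>d a\<bar> / 2"
      using M0 by (simp add: field_simps)
    also have "\<dots> < \<bar>d a\<bar>"
      using da by simp
    finally show ?thesis
      using da by (auto simp: sgn_if abs_if split: if_splits)
  qed
  obtain M' where "power_series_on B r M' (\<lambda>t. \<kappa> * sgn (d a) * d (?x t))"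
    using has_power_series_mult[OF r(1) has_power_series_const[OF r(1)] ps[OF r(1)], of "\<kappa> * sgn (d a)"]
    by (auto simp: has_power_series_def)
  then obtain c where c: "\<And>t. (\<forall>v\<in>B. \<bar>t v\<bar> \<le> r) \<Longrightarrow>
      ((\<lambda>\<alpha>. monomial_at B t \<alpha> * c \<alpha>) has_sum (\<kappa> * sgn (d a) * d (?x t))) (multi_indices B)"
    unfolding power_series_on_def by blast
  show "\<exists>r>0. \<exists>c :: _ \<Rightarrow> real. \<forall>t. (\<forall>v\<in>B. \<bar>t v\<bar> < r) \<longrightarrow> ?x t \<in> S \<and>
      ((\<lambda>\<alpha>. (\<Prod>v\<in>B. t v ^ \<alpha> v) *\<^sub>R c \<alpha>) has_sum \<kappa> * abs_det_wrt T (F (?x t))) (multi_indices B)"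
  proof (intro exI conjI allI impI)
    fix t assume t: "\<forall>v\<in>B. \<bar>t v\<bar> < r"
    then have "\<forall>v\<in>B. \<bar>t v\<bar> < r0"
      using r(3) by fastforce
    then show "?x t \<in> S"
      by (rule r0(2))
    show "((\<lambda>\<alpha>. (\<Prod>v\<in>B. t v ^ \<alpha> v) *\<^sub>R c \<alpha>) has_sum \<kappa> * abs_det_wrt T (F (?x t))) (multi_indices B)"
      using c[of t] close[of t] t by (simp add: det monomial_at_def less_imp_le mult.assoc)
  qed (rule r)
qed

text \<open>Applied to the logarithm on \<open>exp U\<close>, this pointwise estimate yields its continuity and the injectivity
of the derivative of \<open>exp\<close>.\<close>

lemma real_analytic_on_lipschitz:
  fixes f :: "'a::euclidean_space \<Rightarrow> 'b::euclidean_space"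
  assumes f: "real_analytic_on Basis f S" and a: "a \<in> S"
  obtains \<delta> C where "0 < \<delta>" "0 \<le> C" "\<forall>x. norm (x - a) < \<delta> \<longrightarrow> x \<in> S \<and> norm (f x - f a) \<le> C * norm (x - a)"
proof -
  let ?x = "\<lambda>t. a + (\<Sum>v\<in>Basis. t v *\<^sub>R v)"
  obtain r c where r: "0 < r" and "\<forall>t. (\<forall>v\<in>Basis. \<bar>t v\<bar> < r) \<longrightarrow> ?x t \<in> S \<and>
      ((\<lambda>\<alpha>. monomial_at Basis t \<alpha> *\<^sub>R c \<alpha>) has_sum f (?x t)) (multi_indices Basis)"
    using bspec[OF f[unfolded real_analytic_on_def] a] unfolding monomial_at_def by (elim exE conjE)
  then have c: "?x t \<in> S \<and> ((\<lambda>\<alpha>. monomial_at Basis t \<alpha> *\<^sub>R c \<alpha>) has_sum f (?x t)) (multi_indices Basis)"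
    if "\<forall>v\<in>Basis. \<bar>t v\<bar> < r" for t
    using that by simp
  have r2: "0 < r / 2" "r / 2 < r"
    using r by auto
  have "has_power_series Basis (r / 2) (\<lambda>t. f (?x t) \<bullet> b)" for b
  proof -
    have s: "((\<lambda>\<alpha>. monomial_at Basis t \<alpha> * (c \<alpha> \<bullet> b)) has_sum (f (?x t) \<bullet> b)) (multi_indices Basis)"
      if "\<forall>v\<in>Basis. \<bar>t v\<bar> \<le> r / 2" for t
    proof -
      have "\<forall>v\<in>Basis. \<bar>t v\<bar> < r"
        using that r2 by fastforce
      from has_sum_bounded_linear[OF bounded_linear_inner_left conjunct2[OF c[OF this]], of b]
      show ?thesis by simp
    qed
    have "(\<lambda>\<alpha>. monomial_at Basis (\<lambda>_. r / 2) \<alpha> * (c \<alpha> \<bullet> b)) summable_on multi_indices Basis"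
      using s[of "\<lambda>_. r / 2"] r by (auto intro: has_sum_imp_summable)
    then have "(\<lambda>\<alpha>. \<bar>monomial_at Basis (\<lambda>_. r / 2) \<alpha> * (c \<alpha> \<bullet> b)\<bar>) summable_on multi_indices Basis"
      unfolding real_norm_def[symmetric] by (rule summable_on_iff_abs_summable_on_real[THEN iffD1])
    then obtain N where "((\<lambda>\<alpha>. monomial_at Basis (\<lambda>_. r / 2) \<alpha> * \<bar>c \<alpha> \<bullet> b\<bar>) has_sum N) (multi_indices Basis)"
      by (auto simp: summable_on_def abs_mult abs_of_pos[OF monomial_at_pos[OF r2(1)]])
    then show ?thesis
      unfolding has_power_series_def power_series_on_def
      by (intro exI[of _ N] exI[of _ "\<lambda>\<alpha>. c \<alpha> \<bullet> b"]) (use s in simp)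
  qed
  then have "\<forall>b. \<exists>M. power_series_on Basis (r / 2) M (\<lambda>t. f (?x t) \<bullet> b)"
    by (simp add: has_power_series_def)
  from choice[OF this] obtain M where M: "\<And>b. power_series_on Basis (r / 2) (M b) (\<lambda>t. f (?x t) \<bullet> b)"
    by auto
  show ?thesis
  proof (rule that[OF r2(1)])
    show "0 \<le> (\<Sum>b\<in>Basis. M b / (r / 2))"
      using power_series_on_bound_nonneg[OF M r2(1)] r by (intro sum_nonneg) auto
    show "\<forall>x. norm (x - a) < r / 2 \<longrightarrow> x \<in> S \<and> norm (f x - f a) \<le> (\<Sum>b\<in>Basis. M b / (r / 2)) * norm (x - a)"
    proof (intro allI impI conjI)
      fix x assume x: "norm (x - a) < r / 2"
      let ?t = "\<lambda>v. (x - a) \<bullet> v"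
      have xt: "?x ?t = x"
        by (simp only: euclidean_representation) simp
      have t: "\<bar>?t v\<bar> \<le> norm (x - a)" if "v \<in> Basis" for v
        using that by (rule Basis_le_norm)
      have "\<forall>v\<in>Basis. \<bar>?t v\<bar> < r"
        using t x r2 by fastforce
      from conjunct1[OF c[OF this]] show "x \<in> S"
        unfolding xt .
      have "norm (f x - f a) \<le> (\<Sum>b\<in>Basis. \<bar>(f x - f a) \<bullet> b\<bar>)"
        by (rule norm_le_l1)
      also have "\<dots> \<le> (\<Sum>b\<in>Basis. M b / (r / 2) * norm (x - a))"
      proof (rule sum_mono)
        fix b :: 'b
        show "\<bar>(f x - f a) \<bullet> b\<bar> \<le> M b / (r / 2) * norm (x - a)"
          using power_series_on_lipschitz_at_0[where t = ?t,
              OF M[of b] finite_Basis r2(1) norm_ge_zero less_imp_le[OF x] t]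
          unfolding xt by (simp add: inner_diff_left)
      qed
      also have "\<dots> = (\<Sum>b\<in>Basis. M b / (r / 2)) * norm (x - a)"
        by (simp add: sum_distrib_right)
      finally show "norm (f x - f a) \<le> (\<Sum>b\<in>Basis. M b / (r / 2)) * norm (x - a)" .
    qed
  qed
qed

section \<open>Continuity of the derivative of the exponential\<close>

lemma continuous_on_dmexp:
  fixes f :: "'a::topological_space \<Rightarrow> real^'d^'d"
  assumes f: "continuous_on S f"
  shows "continuous_on S (\<lambda>x. dmexp (f x) H)"
proof -
  have "((\<lambda>x. dmexp x H) \<longlongrightarrow> dmexp a H) (at a)" for a :: "real^'d^'d"
  proof (intro vec_tendstoI)
    fix i j
    let ?x = "\<lambda>t. a + (\<Sum>v\<in>Basis. t v *\<^sub>R v)"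
    have "has_power_series Basis 1 (\<lambda>t. dmexp (?x t) H $ i $ j)"
      by (intro has_power_series_dmexp has_power_series_affine[of _ _ "\<lambda>A. A $ _ $ _"])
        (auto intro: linearI)
    then obtain M where M: "power_series_on Basis 1 M (\<lambda>t. dmexp (?x t) H $ i $ j)"
      by (auto simp: has_power_series_def)
    show "((\<lambda>x. dmexp x H $ i $ j) \<longlongrightarrow> dmexp a H $ i $ j) (at a)"
    proof (rule LIM_zero_cancel, rule Lim_null_comparison)
      show "((\<lambda>x. M * norm (x - a)) \<longlongrightarrow> 0) (at a)"
        by (auto intro!: tendsto_eq_intros)
      have "norm (dmexp x H $ i $ j - dmexp a H $ i $ j) \<le> M * norm (x - a)" if x: "norm (x - a) \<le> 1" for x
      proof -
        let ?t = "\<lambda>v. (x - a) \<bullet> v"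
        have xt: "?x ?t = x"
          by (simp only: euclidean_representation) simp
        show ?thesis
          using power_series_on_lipschitz_at_0[where t = ?t, OF M finite_Basis zero_less_one norm_ge_zero x]
          unfolding xt by (simp add: Basis_le_norm)
      qed
      then show "\<forall>\<^sub>F x in at a. norm (dmexp x H $ i $ j - dmexp a H $ i $ j) \<le> M * norm (x - a)"
        unfolding eventually_at by (intro exI[of _ 1]) (auto simp: dist_norm)
    qed
  qed
  then have "continuous_on UNIV (\<lambda>x :: real^'d^'d. dmexp x H)"
    by (simp add: continuous_on_eq_continuous_at isCont_def)
  then show ?thesis
    by (rule continuous_on_compose2) (use f in auto)
qed

lemma continuous_on_matrix_mult [continuous_intros]:
  fixes f g :: "'a::topological_space \<Rightarrow> real^'d^'d"
  assumes "continuous_on S f" "continuous_on S g"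
  shows "continuous_on S (\<lambda>x. f x ** g x)"
  using assms by (rule matrix_mult.continuous_on)

lemma onorm_le_sum_Basis:
  fixes f :: "'a::euclidean_space \<Rightarrow> 'b::real_normed_vector"
  assumes "linear f"
  shows "onorm f \<le> (\<Sum>b\<in>Basis. norm (f b))"
proof (rule onorm_bound)
  fix x
  have "f x = (\<Sum>b\<in>Basis. (x \<bullet> b) *\<^sub>R f b)"
    using linear_sum[OF assms, of "\<lambda>b. (x \<bullet> b) *\<^sub>R b" Basis]
    by (simp add: linear_scale[OF assms] euclidean_representation)
  also have "norm \<dots> \<le> (\<Sum>b\<in>Basis. norm x * norm (f b))"
    by (rule sum_norm_le) (auto intro!: mult_right_mono Basis_le_norm)
  finally show "norm (f x) \<le> (\<Sum>b\<in>Basis. norm (f b)) * norm x"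
    by (simp add: sum_distrib_left mult.commute)
qed (simp add: sum_nonneg)

section \<open>The exponential chart near the identity\<close>

text \<open>\<open>P\<close> is the projection onto the Lie algebra \<open>span B\<close> along the span of the added basis vectors, and
\<open>T\<close> provides coordinates adapted to the extended basis.\<close>

locale lie_group_coordinates =
  fixes G U B :: "(real^'d^'d) set"
    and T :: "real^((real^'d^'d) coord_index) \<Rightarrow> real^'d^'d"
    and P :: "real^'d^'d \<Rightarrow> real^'d^'d"
  assumes group: "matrix_lie_group G"
    and nbhd: "exp_neighbourhood G U"
    and indep: "independent B" and span_B: "span B = lie_algebra G"
    and T: "linear T" "bij T" "bij_betw T Basis (extend_basis B)"
    and P: "linear P" "\<And>v. v \<in> B \<Longrightarrow> P v = v" "\<And>v. v \<in> extend_basis B - B \<Longrightarrow> P v = 0"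
begin

abbreviation "L \<equiv> lie_algebra G"

definition Q :: "real^'d^'d \<Rightarrow> real^'d^'d" where "Q z = z - P z"

definition log :: "real^'d^'d \<Rightarrow> real^'d^'d" where "log = inv_into U mexp"

lemma subspace_L: "subspace L"
  using span_B subspace_span by metis

lemma P_in_L: "P z \<in> L"
proof -
  have "z \<in> span (extend_basis B)"
    by (simp add: indep)
  then have "P z \<in> span B"
  proof (induction rule: span_induct_alt)
    case base
    then show ?case by (simp add: linear_0[OF P(1)] span_zero)
  next
    case (step c x y)
    have "P x \<in> span B"
      using P step by (cases "x \<in> B") (auto intro: span_base span_zero)
    with step show ?case
      by (simp add: linear_add[OF P(1)] linear_scale[OF P(1)] span_add span_scale)
  qed
  then show ?thesis
    by (simp add: span_B)
qed

lemma P_ident: "z \<in> L \<Longrightarrow> P z = z"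
  unfolding span_B[symmetric]
  by (rule linear_eq_on_span[OF P(1) linear_ident, of B]) (auto simp: P(2))

lemma P_P [simp]: "P (P z) = P z"
  by (simp add: P_ident P_in_L)

lemma P_Q [simp]: "P (Q z) = 0"
  by (simp add: Q_def linear_diff[OF P(1)])

lemma P_0 [simp]: "P 0 = 0" and Q_0 [simp]: "Q 0 = 0"
  by (simp_all add: Q_def linear_0[OF P(1)])

lemma P_add_normal: "x \<in> L \<Longrightarrow> P n = 0 \<Longrightarrow> P (x + n) = x"
  and Q_add_normal: "x \<in> L \<Longrightarrow> P n = 0 \<Longrightarrow> Q (x + n) = n"
  by (simp_all add: Q_def linear_add[OF P(1)] P_ident)

lemma linear_Q: "linear Q"
  unfolding Q_def by (rule linear_compose_sub[OF linear_ident P(1)])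

lemma bounded_linear_P: "bounded_linear P" and bounded_linear_Q: "bounded_linear Q"
  using P(1) linear_Q by (simp_all add: linear_conv_bounded_linear)

lemma continuous_on_P [continuous_intros]: "continuous_on S f \<Longrightarrow> continuous_on S (\<lambda>x. P (f x))"
  and continuous_on_Q [continuous_intros]: "continuous_on S f \<Longrightarrow> continuous_on S (\<lambda>x. Q (f x))"
  by (rule bounded_linear.continuous_on[OF bounded_linear_P], assumption)
    (rule bounded_linear.continuous_on[OF bounded_linear_Q], assumption)

lemma mexp_in_G: "x \<in> L \<Longrightarrow> mexp x \<in> G"
  by (auto simp: lie_algebra_def dest: spec[of _ 1])

lemma mult_in_G: "g \<in> G \<Longrightarrow> h \<in> G \<Longrightarrow> g ** h \<in> G"
  and one_in_G: "mat 1 \<in> G"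
  and inv_in_G: "g \<in> G \<Longrightarrow> matrix_inv g \<in> G"
  using group by (auto simp: matrix_lie_group_def)

lemma matrix_inv_left: "g \<in> G \<Longrightarrow> matrix_inv g ** g = mat 1"
  and matrix_inv_right: "g \<in> G \<Longrightarrow> g ** matrix_inv g = mat 1"
proof -
  have "matrix_inv g ** g = mat 1 \<and> g ** matrix_inv g = mat 1" if "g \<in> G"
  proof -
    have "invertible g"
      using group that closedin_subset unfolding matrix_lie_group_def by fastforce
    then show ?thesis
      unfolding invertible_def matrix_inv_def by (rule someI2_ex) simp
  qed
  then show "g \<in> G \<Longrightarrow> matrix_inv g ** g = mat 1" "g \<in> G \<Longrightarrow> g ** matrix_inv g = mat 1"
    by blast+
qed

lemma inv_mult_cancel: "g \<in> G \<Longrightarrow> matrix_inv g ** (g ** X) = X"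
  by (simp add: matrix_mul_assoc matrix_inv_left)

lemma mult_inv_cancel: "g \<in> G \<Longrightarrow> g ** (matrix_inv g ** X) = X"
  by (simp add: matrix_mul_assoc matrix_inv_right)

lemma U: "open U" "0 \<in> U" "inj_on mexp U"
  using nbhd by (auto simp: exp_neighbourhood_def)

lemma log_mexp: "x \<in> U \<Longrightarrow> log (mexp x) = x"
  by (simp add: log_def U)

lemma mexp_log: "y \<in> mexp ` U \<Longrightarrow> mexp (log y) = y"
  by (simp add: log_def f_inv_into_f)

lemma log_lipschitz:
  assumes "x \<in> U"
  obtains \<delta> C where "0 < \<delta>" "0 \<le> C"
    "\<forall>y. norm (y - mexp x) < \<delta> \<longrightarrow> y \<in> mexp ` U \<and> norm (log y - x) \<le> C * norm (y - mexp x)"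
proof -
  have "real_analytic_on Basis log (mexp ` U)"
    using nbhd by (simp add: exp_neighbourhood_def log_def)
  from real_analytic_on_lipschitz[OF this imageI[OF assms]] show ?thesis
    using that unfolding log_mexp[OF assms] .
qed

text \<open>If \<open>(D exp)(x) u = 0\<close> then, for every \<open>e > 0\<close>, a sufficiently short multiple of \<open>u\<close>, again called
\<open>u\<close>, changes \<open>exp x\<close> by at most \<open>e * norm u\<close>, and a Lipschitz logarithm with constant \<open>C\<close> would turn this into \<open>norm u \<le> C * e * norm u\<close>.\<close>

lemma dmexp_injective:
  assumes x: "x \<in> U" and y: "dmexp x y = 0"
  shows "y = 0"
proof (rule ccontr)
  assume "y \<noteq> 0"
  obtain \<delta> C where \<delta>: "0 < \<delta>" "0 \<le> C"
    "\<forall>z. norm (z - mexp x) < \<delta> \<longrightarrow> z \<in> mexp ` U \<and> norm (log z - x) \<le> C * norm (z - mexp x)"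
    using log_lipschitz[OF x] .
  \<comment> \<open>This value gives \<open>C * e < 1\<close>, also for \<open>C = 0\<close>.\<close>
  define e where "e = 1 / (2 * (C + 1))"
  have e: "0 < e" "C * e < 1" "e \<le> 1"
    using \<delta>(2) by (auto simp: e_def field_simps)
  obtain d where d: "0 < d"
    "\<And>z. norm (z - x) < d \<Longrightarrow> norm (mexp z - mexp x - dmexp x (z - x)) \<le> e * norm (z - x)"
    using has_derivative_mexp[of x] e(1) unfolding has_derivative_at_alt by blast
  obtain \<rho> where \<rho>: "0 < \<rho>" "ball x \<rho> \<subseteq> U"
    using U(1) x open_contains_ball by blast
  \<comment> \<open>A step of length \<open>s\<close> stays in \<open>U\<close> and within reach of both estimates.\<close>
  define s where "s = min (min d \<delta>) \<rho> / 2"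
  have s: "0 < s" "s < d" "s < \<delta>" "s < \<rho>"
    using d(1) \<delta>(1) \<rho>(1) by (auto simp: s_def)
  define u where "u = (s / norm y) *\<^sub>R y"
  have u: "norm u = s" "dmexp x u = 0"
    using s \<open>y \<noteq> 0\<close> y by (auto simp: u_def linear_scale[OF linear_dmexp])
  have "x + u \<in> U"
    using \<rho>(2) u s by (auto simp: dist_norm)
  then have log: "log (mexp (x + u)) - x = u"
    by (simp add: log_mexp)
  have small: "norm (mexp (x + u) - mexp x) \<le> e * s"
    using d(2)[of "x + u"] u s by simp
  also have "e * s \<le> 1 * s"
    using e s by (intro mult_right_mono) auto
  also have "1 * s < \<delta>"
    using s by simp
  finally have "norm u \<le> C * norm (mexp (x + u) - mexp x)"
    using \<delta>(3) log by metis
  also have "\<dots> \<le> C * (e * s)"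
    using small \<delta>(2) by (rule mult_left_mono)
  also have "\<dots> < s"
    using mult_strict_right_mono[OF e(2) s(1)] by (simp add: mult.assoc)
  finally show False
    using u by simp
qed

text \<open>\<open>log\<close> is a continuous local inverse of \<open>exp\<close>, whose derivative at \<open>0\<close> is the identity.\<close>

lemma log_derivative_at_one: "(log has_derivative (\<lambda>h. h)) (at (mat 1))"
proof -
  obtain \<delta> C where \<delta>: "0 < \<delta>" "0 \<le> C"
    "\<forall>y. norm (y - mat 1) < \<delta> \<longrightarrow> y \<in> mexp ` U \<and> norm (log y - 0) \<le> C * norm (y - mat 1)"
    using log_lipschitz[OF U(2)] by (auto simp: mexp_0)
  have log1: "log (mat 1) = 0"
    using log_mexp[OF U(2)] by simp
  have "(log \<longlongrightarrow> 0) (at (mat 1))"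
  proof (rule Lim_null_comparison)
    show "((\<lambda>y. C * norm (y - mat 1)) \<longlongrightarrow> 0) (at (mat 1))"
      by (auto intro!: tendsto_eq_intros)
    show "\<forall>\<^sub>F y in at (mat 1). norm (log y) \<le> C * norm (y - mat 1)"
      unfolding eventually_at using \<delta> by (intro exI[of _ \<delta>]) (auto simp: dist_norm)
  qed
  then have cont: "continuous (at (mat 1)) log"
    by (simp add: isCont_def log1)
  show ?thesis
  proof (rule has_derivative_inverse_basic[of mexp "\<lambda>h. h"])
    show "(mexp has_derivative (\<lambda>h. h)) (at (log (mat 1)))"
      using has_derivative_mexp[of "0 :: real^'d^'d"] by (simp add: log1 dmexp_0[abs_def])
    show "mat 1 \<in> ball (mat 1) \<delta>"
      using \<delta>(1) by simp
    show "mexp (log z) = z" if "z \<in> ball (mat 1) \<delta>" for z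
      using \<delta>(3) that by (intro mexp_log) (simp add: dist_norm norm_minus_commute)
  qed (use cont in \<open>auto simp: fun_eq_iff bounded_linear_ident\<close>)
qed

lemma G_near_one:
  obtains W where "open W" "mat 1 \<in> W" "\<forall>g\<in>G. g \<in> W \<longrightarrow> log g \<in> L \<and> log g \<in> U \<and> mexp (log g) = g"
proof -
  obtain V where V: "openin (top_of_set G) V" "mat 1 \<in> V" "V \<subseteq> mexp ` (L \<inter> U)"
    using nbhd by (auto simp: exp_neighbourhood_def)
  then obtain W where W: "open W" "V = G \<inter> W"
    by (auto simp: openin_open)
  show ?thesis
  proof (rule that[OF W(1)])
    show "mat 1 \<in> W"
      using V W by auto
    show "\<forall>g\<in>G. g \<in> W \<longrightarrow> log g \<in> L \<and> log g \<in> U \<and> mexp (log g) = g"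
      using V W by (auto simp: log_mexp)
  qed
qed

text \<open>The derivative of \<open>exp\<close> at \<open>x\<close>, translated back from \<open>exp x\<close> to the identity.\<close>

definition left_dmexp :: "real^'d^'d \<Rightarrow> real^'d^'d \<Rightarrow> real^'d^'d" where
  "left_dmexp x y = mexp (- x) ** dmexp x y"

lemma linear_left_dmexp: "linear (left_dmexp x)"
  unfolding left_dmexp_def
  using linear_compose[OF linear_dmexp linear_matrix_mult_left] by (simp add: o_def)

lemma mexp_minus_right: "mexp x ** mexp (- x) = mat 1"
  using mexp_minus[of "- x"] by simp

lemma dmexp_eq_left: "dmexp x y = mexp x ** left_dmexp x y"
  by (simp add: left_dmexp_def matrix_mul_assoc mexp_minus_right)

text \<open>The curve \<open>t \<mapsto> exp (-x) exp (x + t y)\<close> stays in \<open>G\<close>, starts at \<open>1\<close> and has velocity \<open>left_dmexp x y\<close>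
there. Its logarithm lies in \<open>L\<close> for small \<open>t\<close> and has the same velocity, so the velocity is a limit
of elements of the closed set \<open>L\<close>.\<close>

theorem left_dmexp_in_L:
  assumes x: "x \<in> L" and y: "y \<in> L"
  shows "left_dmexp x y \<in> L"
proof -
  define \<gamma> where "\<gamma> = (\<lambda>t::real. mexp (- x) ** mexp (x + t *\<^sub>R y))"
  have \<gamma>G: "\<gamma> t \<in> G" for t
    unfolding \<gamma>_def using x y subspace_L
    by (intro mult_in_G mexp_in_G subspace_add subspace_neg subspace_scale)
  have \<gamma>0: "\<gamma> 0 = mat 1"
    by (simp add: \<gamma>_def mexp_minus)
  have "((\<lambda>t. x + t *\<^sub>R y) has_derivative (\<lambda>h. h *\<^sub>R y)) (at 0)"
    by (auto intro!: derivative_eq_intros)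
  moreover have "(mexp has_derivative dmexp x) (at (x + 0 *\<^sub>R y))"
    using has_derivative_mexp[of x] by simp
  ultimately have "((\<lambda>t. mexp (x + t *\<^sub>R y)) has_derivative (\<lambda>h. dmexp x (h *\<^sub>R y))) (at 0)"
    using diff_chain_at by (fastforce simp: o_def)
  then have "(\<gamma> has_derivative (\<lambda>h. mexp (- x) ** dmexp x (h *\<^sub>R y))) (at 0)"
    unfolding \<gamma>_def by (rule bounded_linear.has_derivative[OF matrix_mult.bounded_linear_right])
  moreover have "mexp (- x) ** dmexp x (h *\<^sub>R y) = h *\<^sub>R left_dmexp x y" for h
    by (simp add: left_dmexp_def linear_scale[OF linear_dmexp] matrix_mult.scaleR_right)
  ultimately have d\<gamma>: "(\<gamma> has_derivative (\<lambda>h. h *\<^sub>R left_dmexp x y)) (at 0)"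
    by simp
  have "(log has_derivative (\<lambda>h. h)) (at (\<gamma> 0))"
    using log_derivative_at_one by (simp add: \<gamma>0)
  from diff_chain_at[OF d\<gamma> this]
  have dlog: "((\<lambda>t. log (\<gamma> t)) has_derivative (\<lambda>h. h *\<^sub>R left_dmexp x y)) (at 0)"
    by (simp add: o_def)
  obtain W where W: "open W" "mat 1 \<in> W" "\<forall>g\<in>G. g \<in> W \<longrightarrow> log g \<in> L \<and> log g \<in> U \<and> mexp (log g) = g"
    using G_near_one .
  have "isCont \<gamma> 0"
    using d\<gamma> by (rule has_derivative_continuous)
  then have "\<forall>\<^sub>F t in at 0. \<gamma> t \<in> W"
    using W \<gamma>0 by (intro topological_tendstoD) (auto simp: isCont_def)
  then obtain d1 where d1: "0 < d1" "\<And>t. t \<noteq> 0 \<Longrightarrow> \<bar>t\<bar> < d1 \<Longrightarrow> \<gamma> t \<in> W"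
    unfolding eventually_at by (auto simp: dist_norm)
  have log1: "log (\<gamma> 0) = 0"
    using log_mexp[OF U(2)] \<gamma>0 by simp
  have "left_dmexp x y \<in> closure L"
    unfolding closure_approachable
  proof (intro allI impI)
    fix e :: real assume e: "0 < e"
    then have "0 < e / 2" by simp
    with dlog obtain d2 where d2: "0 < d2"
      "\<And>t. norm (t - 0) < d2 \<Longrightarrow> norm (log (\<gamma> t) - log (\<gamma> 0) - (t - 0) *\<^sub>R left_dmexp x y) \<le> e / 2 * norm (t - 0)"
      unfolding has_derivative_at_alt by blast
    define t where "t = min d1 d2 / 2"
    have t: "0 < t" "t < d1" "t < d2"
      using d1(1) d2(1) by (auto simp: t_def)
    have "norm (log (\<gamma> t) - t *\<^sub>R left_dmexp x y) \<le> e / 2 * t"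
      using d2(2)[of t] t by (simp add: log1)
    moreover have "log (\<gamma> t) - t *\<^sub>R left_dmexp x y = t *\<^sub>R ((1 / t) *\<^sub>R log (\<gamma> t) - left_dmexp x y)"
      using t by (simp add: scaleR_diff_right)
    ultimately have "t * norm ((1 / t) *\<^sub>R log (\<gamma> t) - left_dmexp x y) \<le> t * (e / 2)"
      using t by (simp add: mult.commute)
    then have "dist ((1 / t) *\<^sub>R log (\<gamma> t)) (left_dmexp x y) \<le> e / 2"
      using t by (simp add: dist_norm)
    moreover have "(1 / t) *\<^sub>R log (\<gamma> t) \<in> L"
      using W(3)[rule_format, OF \<gamma>G[of t] d1(2)[of t]] t subspace_L by (intro subspace_scale) auto
    ultimately show "\<exists>z\<in>L. dist z (left_dmexp x y) < e"
      using e by (intro bexI[of _ "(1 / t) *\<^sub>R log (\<gamma> t)"]) auto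
  qed
  then show ?thesis
    using closed_subspace[OF subspace_L] by simp
qed

definition tube_map :: "real^'d^'d \<Rightarrow> real^'d^'d" where
  "tube_map z = mexp (P z) ** (mat 1 + Q z)"

definition dtube_map :: "real^'d^'d \<Rightarrow> real^'d^'d \<Rightarrow> real^'d^'d" where
  "dtube_map z h = mexp (P z) ** Q h + dmexp (P z) (P h) ** (mat 1 + Q z)"

lemma has_derivative_tube_map: "(tube_map has_derivative dtube_map z) (at z)"
proof -
  have "((\<lambda>z. mexp (P z)) has_derivative (\<lambda>h. dmexp (P z) (P h))) (at z)"
    using diff_chain_at[OF bounded_linear_imp_has_derivative[OF bounded_linear_P] has_derivative_mexp]
    by (simp add: o_def)
  moreover have "((\<lambda>z. mat 1 + Q z) has_derivative Q) (at z)"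
    using has_derivative_add[OF has_derivative_const bounded_linear_imp_has_derivative[OF bounded_linear_Q]]
    by simp
  ultimately show ?thesis
    unfolding tube_map_def[abs_def] dtube_map_def[abs_def] by (rule matrix_mult.FDERIV)
qed

lemma continuous_on_tube_map: "continuous_on S tube_map"
  unfolding tube_map_def[abs_def] by (intro continuous_intros)

text \<open>The derivative at \<open>0\<close> is the identity and depends continuously on the base point.\<close>

lemma tube_map_injective_near_0:
  obtains r where "0 < r" "inj_on tube_map (ball 0 r)"
proof (rule has_derivative_locally_injective[of 0 UNIV "\<lambda>h. h" dtube_map tube_map])
  have d0: "dtube_map 0 h = h" for h
    by (simp add: dtube_map_def Q_def)
  show "(\<lambda>h. h) \<circ> dtube_map 0 = id"
    by (simp add: d0 fun_eq_iff)
  show "\<exists>d>0. \<forall>z. dist 0 z < d \<longrightarrow> onorm (\<lambda>v. dtube_map z v - dtube_map 0 v) < e" if "0 < e" for e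
  proof -
    let ?s = "\<lambda>z. \<Sum>b\<in>Basis. norm (dtube_map z b - dtube_map 0 b)"
    have "continuous_on UNIV ?s"
      unfolding dtube_map_def by (intro continuous_intros continuous_on_dmexp)
    then have "isCont ?s 0"
      by (simp add: continuous_on_eq_continuous_at)
    then obtain d where d: "0 < d" "\<And>z. dist z 0 < d \<Longrightarrow> dist (?s z) (?s 0) < e"
      using \<open>0 < e\<close> unfolding continuous_at_eps_delta by blast
    have "onorm (\<lambda>v. dtube_map z v - dtube_map 0 v) < e" if z: "dist 0 z < d" for z
    proof -
      have "linear (\<lambda>v. dtube_map z v - dtube_map 0 v)"
        by (intro linear_compose_sub has_derivative_linear[OF has_derivative_tube_map])
      then have "onorm (\<lambda>v. dtube_map z v - dtube_map 0 v) \<le> ?s z"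
        by (rule onorm_le_sum_Basis)
      also have "?s z < e"
        using d(2)[of z] z by (simp add: dist_commute)
      finally show ?thesis .
    qed
    with d(1) show ?thesis by blast
  qed
qed (use has_derivative_tube_map that in \<open>auto simp: bounded_linear_ident\<close>)

text \<open>With \<open>h = g'\<inverse> g\<close> the assumption reads \<open>h (1 + n) = 1 + n'\<close>, that is \<open>h - 1 = n' - h n\<close>. For small
\<open>n\<close> and \<open>n'\<close> this forces \<open>h\<close> close to \<open>1\<close>, hence \<open>h = exp (log h)\<close> with \<open>log h\<close> small in \<open>L\<close>, and
both sides are values of the locally injective map \<open>tube_map\<close>.\<close>

theorem tube_radius:
  obtains \<epsilon> where "0 < \<epsilon>"
    "\<forall>g\<in>G. \<forall>g'\<in>G. \<forall>n n'. P n = 0 \<longrightarrow> P n' = 0 \<longrightarrow> norm n < \<epsilon> \<longrightarrow> norm n' < \<epsilon> \<longrightarrow>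
      g ** (mat 1 + n) = g' ** (mat 1 + n') \<longrightarrow> g = g' \<and> n = n'"
proof -
  obtain r where r: "0 < r" "inj_on tube_map (ball 0 r)"
    using tube_map_injective_near_0 .
  obtain W where W: "open W" "mat 1 \<in> W" "\<forall>g\<in>G. g \<in> W \<longrightarrow> log g \<in> L \<and> log g \<in> U \<and> mexp (log g) = g"
    using G_near_one .
  have "isCont log (mat 1)"
    using log_derivative_at_one by (rule has_derivative_continuous)
  moreover have "log (mat 1) = 0"
    using log_mexp[OF U(2)] by simp
  ultimately obtain d1 where d1: "0 < d1" "\<And>h. dist h (mat 1) < d1 \<Longrightarrow> norm (log h) < r / 2"
    using r(1) unfolding continuous_at_eps_delta by (metis dist_0_norm dist_commute half_gt_zero)
  obtain d2 where d2: "0 < d2" "ball (mat 1) d2 \<subseteq> W"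
    using W open_contains_ball by blast
  define d where "d = min d1 d2"
  have d: "0 < d" "d \<le> d1" "d \<le> d2"
    using d1 d2 by (auto simp: d_def)
  have "\<exists>K0>0. \<forall>(A :: real^'d^'d) B :: real^'d^'d. norm (A ** B) \<le> norm A * norm B * K0"
    by (rule matrix_mult.pos_bounded)
  then obtain K where K: "0 < K" "\<And>(A :: real^'d^'d) B :: real^'d^'d. norm (A ** B) \<le> norm A * norm B * K"
    by auto
  let ?N = "norm (mat 1 :: real^'d^'d)"
  define c where "c = 1 + K * ?N"
  have c: "0 < c"
    using K by (auto simp: c_def intro: add_pos_nonneg)
  \<comment> \<open>The three bounds keep \<open>log h + n\<close> in the ball of radius \<open>r\<close>, absorb \<open>norm (h - 1)\<close> on the right, and force \<open>norm (h - 1) < d\<close>.\<close>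
  define \<epsilon> where "\<epsilon> = min (min (r / 2) (1 / (2 * K))) (d / (4 * c))"
  have \<epsilon>: "0 < \<epsilon>" "\<epsilon> \<le> r / 2" "\<epsilon> \<le> 1 / (2 * K)" "\<epsilon> \<le> d / (4 * c)"
    using r d K c by (auto simp: \<epsilon>_def)
  show ?thesis
  proof (rule that[OF \<epsilon>(1)], intro ballI allI impI)
    fix g g' n n'
    assume g: "g \<in> G" "g' \<in> G" and n: "P n = 0" "P n' = 0" "norm n < \<epsilon>" "norm n' < \<epsilon>"
      and eq: "g ** (mat 1 + n) = g' ** (mat 1 + n')"
    define h where "h = matrix_inv g' ** g"
    have hG: "h \<in> G"
      unfolding h_def using g by (intro mult_in_G inv_in_G)
    have g_eq: "g = g' ** h"
      using g by (simp add: h_def matrix_mul_assoc matrix_inv_right)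
    have hn: "h ** (mat 1 + n) = mat 1 + n'"
      using eq inv_mult_cancel[OF g(2)] by (simp add: h_def flip: matrix_mul_assoc)
    then have "h - mat 1 = n' - h ** n"
      by (simp add: matrix_mult.add_right algebra_simps)
    then have "norm (h - mat 1) \<le> norm n' + norm (h ** n)"
      by (metis norm_triangle_ineq4)
    also have "norm (h ** n) \<le> norm h * norm n * K"
      by (rule K)
    also have "norm h \<le> norm (h - mat 1) + ?N"
      using norm_triangle_ineq[of "h - mat 1" "mat 1"] by simp
    finally have "norm (h - mat 1) \<le> norm n' + (norm (h - mat 1) + ?N) * norm n * K"
      using K(1) by (simp add: mult_right_mono)
    also have "\<dots> \<le> \<epsilon> + (norm (h - mat 1) + ?N) * (\<epsilon> * K)"
      using n K(1) by (auto intro!: add_mono mult_left_mono mult_right_mono simp: mult.assoc)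
    also have "\<dots> = \<epsilon> * c + norm (h - mat 1) * (\<epsilon> * K)"
      by (simp add: c_def algebra_simps)
    also have "\<dots> \<le> \<epsilon> * c + norm (h - mat 1) * (1 / 2)"
    proof -
      have "\<epsilon> * K \<le> 1 / 2"
        using \<epsilon>(3) K(1) by (simp add: field_simps)
      then show ?thesis
        by (intro add_left_mono mult_left_mono) auto
    qed
    finally have "norm (h - mat 1) \<le> 2 * (\<epsilon> * c)"
      by simp
    also have "\<dots> \<le> d / 2"
      using \<epsilon>(4) c by (simp add: field_simps)
    also have "\<dots> < d"
      using d by simp
    finally have hd: "dist h (mat 1) < d"
      by (simp add: dist_norm)
    then have "h \<in> W"
      using d d2 by (auto simp: dist_commute)
    with W(3)[rule_format, OF hG] have x: "log h \<in> L" "mexp (log h) = h"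
      by auto
    have "norm (log h) < r / 2"
      using d1 hd d by auto
    with n \<epsilon> have in_ball: "log h + n \<in> ball 0 r" "n' \<in> ball 0 r"
      using norm_triangle_ineq[of "log h" n] by auto
    have "tube_map (log h + n) = h ** (mat 1 + n)"
      using x n by (simp add: tube_map_def P_add_normal Q_add_normal)
    also have "\<dots> = tube_map n'"
      using n by (simp add: hn tube_map_def Q_def)
    finally have sum: "log h + n = n'"
      using r(2) in_ball by (auto dest: inj_onD)
    then have "log h = P n'"
      using x n by (metis P_add_normal)
    with n have "log h = 0" by simp
    moreover from this have "h = mat 1"
      using x(2) by simp
    ultimately show "g = g' \<and> n = n'"
      using sum g_eq by simp
  qed
qed

end

section \<open>The tube around the group and its Haar measure\<close>

text \<open>An injective linear map of finite-dimensional spaces is bounded below.\<close>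

lemma bounded_linear_vimage_bounded:
  fixes T :: "'a::euclidean_space \<Rightarrow> 'b::euclidean_space"
  assumes "linear T" "inj T" "bounded A"
  shows "bounded (T -` A)"
proof -
  obtain c where c: "0 < c" "\<And>x. c * norm x \<le> norm (T x)"
    using linear_inj_bounded_below_pos[OF assms(1,2)] by (metis mult.commute)
  obtain R where R: "\<And>y. y \<in> A \<Longrightarrow> norm y \<le> R"
    using assms(3) by (auto simp: bounded_iff)
  have "norm x \<le> R / c" if "T x \<in> A" for x
    using order_trans[OF c(2) R[OF that]] c(1) by (simp add: field_simps)
  then show ?thesis
    by (auto simp: bounded_iff)
qed

locale lie_group_tube = lie_group_coordinates G U B T P
  for G U B :: "(real^'d^'d) set" and T P +
  fixes \<epsilon> :: real
  assumes \<epsilon>_pos: "0 < \<epsilon>"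
    and tube_unique: "\<forall>g\<in>G. \<forall>g'\<in>G. \<forall>n n'. P n = 0 \<longrightarrow> P n' = 0 \<longrightarrow> norm n < \<epsilon> \<longrightarrow> norm n' < \<epsilon> \<longrightarrow>
      g ** (mat 1 + n) = g' ** (mat 1 + n') \<longrightarrow> g = g' \<and> n = n'"
begin

definition "normal_disc = {n. P n = 0 \<and> norm n < \<epsilon>}"

definition "Tube = {g ** (mat 1 + n) | g n. g \<in> G \<and> n \<in> normal_disc}"

text \<open>The value outside the tube is an arbitrary element of \<open>G\<close>; it makes \<open>foot\<close> a map into \<open>G\<close> everywhere.\<close>

definition foot :: "real^'d^'d \<Rightarrow> real^'d^'d" where
  "foot X = (if X \<in> Tube then (THE g. g \<in> G \<and> (\<exists>n\<in>normal_disc. X = g ** (mat 1 + n))) else mat 1)"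

lemma TubeI: "g \<in> G \<Longrightarrow> n \<in> normal_disc \<Longrightarrow> g ** (mat 1 + n) \<in> Tube"
  unfolding Tube_def by blast

lemma foot_eq:
  assumes "g \<in> G" "n \<in> normal_disc"
  shows "foot (g ** (mat 1 + n)) = g"
proof -
  have "(THE g'. g' \<in> G \<and> (\<exists>n'\<in>normal_disc. g ** (mat 1 + n) = g' ** (mat 1 + n'))) = g"
    using assms tube_unique by (intro the_equality) (auto simp: normal_disc_def)
  then show ?thesis
    using TubeI[OF assms] by (simp add: foot_def)
qed

lemma foot_in_G: "foot X \<in> G"
proof (cases "X \<in> Tube")
  case True
  then show ?thesis
    unfolding Tube_def using foot_eq by auto
qed (simp add: foot_def one_in_G)

lemma TubeE:
  assumes "X \<in> Tube"
  obtains n where "n \<in> normal_disc" "X = foot X ** (mat 1 + n)"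
  using assms foot_eq unfolding Tube_def by auto

lemma mult_in_Tube:
  assumes "g \<in> G" "X \<in> Tube"
  shows "g ** X \<in> Tube" "foot (g ** X) = g ** foot X"
proof -
  obtain n where n: "n \<in> normal_disc" "X = foot X ** (mat 1 + n)"
    using TubeE[OF assms(2)] .
  have eq: "g ** X = (g ** foot X) ** (mat 1 + n)"
    by (subst n(2)) (simp add: matrix_mul_assoc)
  have "g ** foot X \<in> G"
    using assms foot_in_G mult_in_G by blast
  with n(1) show "g ** X \<in> Tube" "foot (g ** X) = g ** foot X"
    unfolding eq using TubeI foot_eq by auto
qed

lemma mult_in_Tube_iff: "g \<in> G \<Longrightarrow> g ** X \<in> Tube \<longleftrightarrow> X \<in> Tube"
  using mult_in_Tube(1) inv_mult_cancel inv_in_G by metis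

definition "chart_domain = {z. P z \<in> U \<and> norm (Q z) < \<epsilon>}"

lemma open_chart_domain: "open chart_domain"
proof -
  have "chart_domain = P -` U \<inter> (\<lambda>z. norm (Q z)) -` {..<\<epsilon>}"
    by (auto simp: chart_domain_def)
  then show ?thesis
    by (auto intro!: open_Int open_vimage U continuous_intros)
qed

lemma tube_map_chart:
  assumes "g \<in> G" "z \<in> chart_domain"
  shows "g ** tube_map z \<in> Tube" "foot (g ** tube_map z) = g ** mexp (P z)"
proof -
  have eq: "g ** tube_map z = (g ** mexp (P z)) ** (mat 1 + Q z)"
    by (simp add: tube_map_def matrix_mul_assoc)
  have "g ** mexp (P z) \<in> G" "Q z \<in> normal_disc"
    using assms by (auto simp: normal_disc_def chart_domain_def mult_in_G mexp_in_G P_in_L)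
  then show "g ** tube_map z \<in> Tube" "foot (g ** tube_map z) = g ** mexp (P z)"
    unfolding eq using TubeI foot_eq by auto
qed

lemma inj_on_tube_chart:
  assumes g: "g \<in> G"
  shows "inj_on (\<lambda>z. g ** tube_map z) chart_domain"
proof (rule inj_onI)
  fix z w assume zw: "z \<in> chart_domain" "w \<in> chart_domain" and eq: "g ** tube_map z = g ** tube_map w"
  then have "tube_map z = tube_map w"
    using inv_mult_cancel[OF g] by metis
  then have "mexp (P z) = mexp (P w) \<and> Q z = Q w"
    using zw tube_unique[rule_format, OF mexp_in_G[OF P_in_L] mexp_in_G[OF P_in_L] P_Q P_Q, of z w]
    by (auto simp: tube_map_def chart_domain_def)
  moreover have "P z = P w"
    using calculation zw U(3) by (auto simp: chart_domain_def dest: inj_onD)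
  ultimately show "z = w"
    by (simp add: Q_def)
qed

lemma continuous_on_tube_chart: "continuous_on S (\<lambda>z. (g :: real^'d^'d) ** tube_map z)"
  by (intro continuous_intros continuous_on_tube_map)

lemma open_tube_chart: "g \<in> G \<Longrightarrow> open ((\<lambda>z. g ** tube_map z) ` chart_domain)"
  by (rule invariance_of_domain[OF continuous_on_tube_chart open_chart_domain inj_on_tube_chart])

text \<open>A point of the tube lies in a chart as soon as its foot point does, because chart domains contain the full
normal disc.\<close>

lemma mem_tube_chart:
  assumes "X \<in> Tube" "foot X = g ** mexp x" "x \<in> L" "x \<in> U"
  shows "X \<in> (\<lambda>z. g ** tube_map z) ` chart_domain"
proof -
  obtain n where n: "n \<in> normal_disc" "X = foot X ** (mat 1 + n)"
    using TubeE[OF assms(1)] .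
  then have "X = g ** tube_map (x + n)"
    using assms by (simp add: tube_map_def normal_disc_def P_add_normal Q_add_normal matrix_mul_assoc)
  moreover have "x + n \<in> chart_domain"
    using n assms by (simp add: chart_domain_def normal_disc_def P_add_normal Q_add_normal)
  ultimately show ?thesis by blast
qed

lemma Tube_eq_charts: "Tube = (\<Union>g\<in>G. (\<lambda>z. g ** tube_map z) ` chart_domain)"
proof
  have "0 \<in> L"
    using subspace_L by (rule subspace_0)
  then show "Tube \<subseteq> (\<Union>g\<in>G. (\<lambda>z. g ** tube_map z) ` chart_domain)"
    using mem_tube_chart[of _ "foot _" 0] foot_in_G U(2) by fastforce
  show "(\<Union>g\<in>G. (\<lambda>z. g ** tube_map z) ` chart_domain) \<subseteq> Tube"
    using tube_map_chart(1) by auto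
qed

lemma open_Tube: "open Tube"
  unfolding Tube_eq_charts by (intro open_UN ballI open_tube_chart)

lemma one_in_Tube: "mat 1 \<in> Tube"
  using TubeI[OF one_in_G, of 0] \<epsilon>_pos by (simp add: normal_disc_def)

text \<open>On each chart, \<open>foot\<close> is the chart inverse, which is continuous by invariance of domain, followed by
\<open>x + n \<mapsto> g exp x\<close>.\<close>

lemma continuous_on_foot: "continuous_on Tube foot"
  unfolding Tube_eq_charts
proof (rule continuous_on_open_UN)
  fix g assume g: "g \<in> G"
  let ?\<phi> = "\<lambda>z. g ** tube_map z"
  show "open (?\<phi> ` chart_domain)"
    by (rule open_tube_chart) fact
  obtain \<psi> where \<psi>: "homeomorphism chart_domain (?\<phi> ` chart_domain) ?\<phi> \<psi>"
    using invariance_of_domain_homeomorphism[OF open_chart_domain continuous_on_tube_chart order_refl inj_on_tube_chart[OF g]] .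
  have "continuous_on (?\<phi> ` chart_domain) (\<lambda>X. g ** mexp (P (\<psi> X)))"
    using \<psi> by (intro continuous_intros) (simp add: homeomorphism_def)
  then show "continuous_on (?\<phi> ` chart_domain) foot"
  proof (rule continuous_on_eq)
    fix X assume "X \<in> ?\<phi> ` chart_domain"
    then show "g ** mexp (P (\<psi> X)) = foot X"
      using \<psi> tube_map_chart(2)[OF g] by (auto simp: homeomorphism_def)
  qed
qed

definition ambient_lebesgue :: "(real^'d^'d) measure" where
  "ambient_lebesgue = coord_lebesgue (extend_basis B)"

lemma ambient_lebesgue_eq: "ambient_lebesgue = distr lborel borel T"
  unfolding ambient_lebesgue_def coord_lebesgue_linear_image[OF T(1,3) finite_Basis] coord_lebesgue_Basis ..

lemma sets_ambient_lebesgue [simp, measurable_cong]: "sets ambient_lebesgue = sets borel" and space_ambient_lebesgue [simp]: "space ambient_lebesgue = UNIV"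
  by (simp_all add: ambient_lebesgue_def)

lemma T_measurable [measurable]: "T \<in> borel_measurable borel"
  by (rule borel_measurable_linear[OF T(1)])

lemma ambient_lebesgue_bounded_finite:
  assumes "bounded A" and [measurable]: "A \<in> sets borel"
  shows "emeasure ambient_lebesgue A < \<infinity>"
proof -
  have "emeasure ambient_lebesgue A = emeasure lborel (T -` A)"
    by (simp add: ambient_lebesgue_eq emeasure_distr)
  also have "\<dots> < \<infinity>"
    by (intro emeasure_bounded_finite bounded_linear_vimage_bounded T assms bij_is_inj)
  finally show ?thesis .
qed

lemma ambient_lebesgue_open_nonzero:
  assumes "open A" "A \<noteq> {}"
  shows "emeasure ambient_lebesgue A \<noteq> 0"
proof -
  have [measurable]: "A \<in> sets borel"
    using assms by simp
  have op: "open (T -` A)"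
    using assms linear_continuous_on[of T UNIV] T(1)
    by (intro open_vimage) (auto simp: linear_conv_bounded_linear)
  have "T -` A \<noteq> {}"
    using assms T(2) by (metis bij_is_surj surj_vimage_empty)
  with op have "T -` A \<notin> null_sets lebesgue"
    using open_not_negligible by (auto simp: negligible_iff_null_sets)
  moreover have "T -` A \<in> sets borel"
    using op by simp
  ultimately have "emeasure lborel (T -` A) \<noteq> 0"
    by (auto simp: null_sets_def)
  then show ?thesis
    by (simp add: ambient_lebesgue_eq emeasure_distr)
qed

lemma nn_integral_ambient_nonzero:
  assumes [measurable]: "f \<in> borel_measurable borel" and "open A" "A \<noteq> {}" "\<And>x. x \<in> A \<Longrightarrow> f x \<noteq> 0"
  shows "(\<integral>\<^sup>+x. f x \<partial>ambient_lebesgue) \<noteq> 0"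
proof
  assume "(\<integral>\<^sup>+x. f x \<partial>ambient_lebesgue) = 0"
  then have "AE x in ambient_lebesgue. f x = 0"
    by (subst (asm) nn_integral_0_iff_AE) auto
  then have "AE x in ambient_lebesgue. x \<notin> A"
    by (rule AE_mp) (use assms in auto)
  then have "emeasure ambient_lebesgue A = 0"
    using \<open>open A\<close> by (subst (asm) AE_iff_measurable[of A]) auto
  with ambient_lebesgue_open_nonzero[OF assms(2,3)] show False ..
qed

abbreviation "abs_det \<equiv> abs_det_wrt T"

text \<open>The factor by which left multiplication by \<open>g\<close> scales Lebesgue measure on the space of matrices.\<close>

definition left_scale :: "real^'d^'d \<Rightarrow> real" where "left_scale g = abs_det ((**) g)"

lemma left_scale_mult: "left_scale (g ** h) = left_scale g * left_scale h"
  using abs_det_wrt_compose[OF T(1,2) linear_matrix_mult_left linear_matrix_mult_left, of g h]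
  by (simp add: left_scale_def matrix_mul_assoc)

lemma left_scale_pos: "g \<in> G \<Longrightarrow> 0 < left_scale g"
  unfolding left_scale_def
proof (rule abs_det_wrt_pos[OF T(1,2) linear_matrix_mult_left])
  show "X = 0" if "g \<in> G" "g ** X = 0" for X
    using inv_mult_cancel[OF that(1), of X] that(2) by (simp add: matrix_mult.zero_right)
qed

lemma continuous_on_left_scale [continuous_intros]: "continuous_on S f \<Longrightarrow> continuous_on S (\<lambda>x. left_scale (f x))"
  unfolding left_scale_def by (intro continuous_on_abs_det_wrt[OF T(1,2)] continuous_intros)

lemma foot_measurable [measurable]: "foot \<in> borel_measurable borel"
proof -
  have "(\<lambda>X. if X \<in> Tube then foot X else mat 1) \<in> borel_measurable borel"
    using open_Tube by (intro borel_measurable_continuous_on_if continuous_on_foot continuous_intros) auto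
  moreover have "(\<lambda>X. if X \<in> Tube then foot X else mat 1) = foot"
    by (auto simp: foot_def)
  ultimately show ?thesis by simp
qed

lemma Tube_measurable [measurable]: "Tube \<in> sets borel"
  using open_Tube by simp

lemma foot_measurable_G [measurable]: "foot \<in> borel \<rightarrow>\<^sub>M restrict_space borel G"
  by (intro measurable_restrict_space2 foot_measurable) (auto intro: foot_in_G)

definition weight :: "real^'d^'d \<Rightarrow> real" where
  "weight X = indicator Tube X / left_scale (foot X)"

lemma left_scale_measurable [measurable]: "left_scale \<in> borel_measurable borel"
  by (intro borel_measurable_continuous_onI continuous_on_left_scale continuous_on_id)

lemma weight_measurable [measurable]: "weight \<in> borel_measurable borel"
  unfolding weight_def by measurable

lemma weight_nonneg: "0 \<le> weight X"
  using left_scale_pos[OF foot_in_G, of X] by (simp add: weight_def less_imp_le)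

text \<open>The weight cancels the scaling of Lebesgue measure under left multiplication.\<close>

definition haar :: "(real^'d^'d) measure" where
  "haar = distr (density ambient_lebesgue (\<lambda>X. ennreal (weight X))) (restrict_space borel G) foot"

lemma sets_haar [simp]: "sets haar = sets (restrict_space borel G)"
  by (simp add: haar_def)

lemma emeasure_haar:
  assumes "A \<in> sets (restrict_space borel G)"
  shows "emeasure haar A = (\<integral>\<^sup>+X. ennreal (weight X) * indicator A (foot X) \<partial>ambient_lebesgue)"
proof -
  have m: "foot -` A \<in> sets borel"
    using measurable_sets[OF foot_measurable_G assms] by simp
  have "emeasure haar A = (\<integral>\<^sup>+X. ennreal (weight X) * indicator (foot -` A) X \<partial>ambient_lebesgue)"
    unfolding haar_def using assms m by (subst emeasure_distr) (auto simp: emeasure_density)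
  then show ?thesis
    by (simp add: indicator_def)
qed

lemma integral_haar:
  assumes f: "f \<in> borel_measurable (restrict_space borel G)"
  shows "(\<integral>x. f x \<partial>haar) = (\<integral>X. indicator Tube X * (f (foot X) / left_scale (foot X)) \<partial>ambient_lebesgue)"
proof -
  have [measurable]: "(\<lambda>X. f (foot X)) \<in> borel_measurable borel"
    by (rule measurable_compose[OF foot_measurable_G f])
  have "(\<integral>x. f x \<partial>haar) = (\<integral>X. f (foot X) \<partial>density ambient_lebesgue (\<lambda>X. ennreal (weight X)))"
    unfolding haar_def by (rule integral_distr[OF _ f]) simp
  also have "\<dots> = (\<integral>X. weight X *\<^sub>R f (foot X) \<partial>ambient_lebesgue)"
    by (rule integral_density) (auto simp: weight_nonneg)
  finally show ?thesis
    by (simp add: weight_def)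
qed

lemma Cc_measurable: "f \<in> Cc G \<Longrightarrow> f \<in> borel_measurable (restrict_space borel G)"
  by (simp add: Cc_def borel_measurable_continuous_on_restrict)

lemma foot_compose_measurable:
  "f \<in> borel_measurable (restrict_space borel G) \<Longrightarrow>
    (\<lambda>X. indicator Tube X * (f (foot X) / left_scale (foot X)) :: real) \<in> borel_measurable borel"
proof -
  assume f: "f \<in> borel_measurable (restrict_space borel G)"
  have [measurable]: "(\<lambda>X. f (foot X)) \<in> borel_measurable borel"
    by (rule measurable_compose[OF foot_measurable_G f])
  show ?thesis by measurable
qed

text \<open>The substitution \<open>X \<mapsto> g X\<close> maps the tube onto itself and multiplies Lebesgue measure by
\<open>left_scale g\<close>, while the weight at \<open>g X\<close> carries the factor \<open>1 / left_scale g\<close>.\<close>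

lemma left_invariant_haar: "left_invariant G haar"
  unfolding left_invariant_def
proof (intro ballI)
  fix g f assume g: "g \<in> G" and f: "f \<in> Cc G"
  let ?h = "\<lambda>X. indicator Tube X * (f (foot X) / left_scale (foot X))"
  have fg: "(\<lambda>x. f (g ** x)) \<in> borel_measurable (restrict_space borel G)"
  proof (rule borel_measurable_continuous_on_restrict)
    have "continuous_on G f"
      using f by (simp add: Cc_def)
    then show "continuous_on G (\<lambda>x. f (g ** x))"
      by (rule continuous_on_compose2) (auto intro!: continuous_intros mult_in_G g)
  qed
  have eq: "left_scale g * ?h (g ** X) = indicator Tube X * (f (g ** foot X) / left_scale (foot X))" for X
    using left_scale_pos[OF g] mult_in_Tube(2)[OF g] mult_in_Tube_iff[OF g]
    by (auto simp: indicator_def left_scale_mult)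
  have surj: "range ((**) g) = UNIV"
    using mult_inv_cancel[OF g] by (metis surjI)
  have "(\<integral>x. f x \<partial>haar) = (\<integral>X. indicator (range ((**) g)) X * ?h X \<partial>ambient_lebesgue)"
    by (simp add: integral_haar[OF Cc_measurable[OF f]] surj)
  also have "\<dots> = (\<integral>X. indicator UNIV X * (abs_det ((**) g) * ?h (g ** X)) \<partial>ambient_lebesgue)"
    unfolding ambient_lebesgue_eq
  proof (rule integral_change_of_variables_wrt[OF T(1,2)])
    show "((**) g has_derivative (**) g) (at X)" for X :: "real^'d^'d"
      by (rule bounded_linear_imp_has_derivative[OF matrix_mult.bounded_linear_right])
    show "inj ((**) g)"
      using inv_mult_cancel[OF g] by (metis injI)
    show "(\<lambda>X. indicator (range ((**) g)) X * ?h X) \<in> borel_measurable borel"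
      using foot_compose_measurable[OF Cc_measurable[OF f]] by (simp add: surj)
    show "(\<lambda>X. indicator UNIV X * (abs_det ((**) g) * ?h (g ** X))) \<in> borel_measurable borel"
      using foot_compose_measurable[OF fg] by (simp only: left_scale_def[symmetric] eq) simp
  qed simp
  also have "\<dots> = (\<integral>x. f (g ** x) \<partial>haar)"
    unfolding integral_haar[OF fg] left_scale_def[symmetric] eq by simp
  finally show "(\<integral>x. f (g ** x) \<partial>haar) = (\<integral>x. f x \<partial>haar)" ..
qed

lemma haar_nonzero: "emeasure haar G \<noteq> 0"
proof -
  have G: "G \<in> sets (restrict_space borel G)"
    using sets.top[of "restrict_space borel G"] by (simp add: space_restrict_space)
  have "(\<integral>\<^sup>+X. ennreal (weight X) \<partial>ambient_lebesgue) \<noteq> 0"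
  proof (rule nn_integral_ambient_nonzero[of _ Tube])
    show "ennreal (weight X) \<noteq> 0" if "X \<in> Tube" for X
      using that left_scale_pos[OF foot_in_G, of X] by (simp add: weight_def)
  qed (use open_Tube one_in_Tube in auto)
  then show ?thesis
    by (simp add: emeasure_haar[OF G] foot_in_G)
qed

text \<open>The part of the tube over a compact set is bounded, and the weight is bounded there.\<close>

lemma haar_compact_finite:
  assumes K: "compact K" "K \<subseteq> G"
  shows "emeasure haar K < \<infinity>"
proof (cases "K = {}")
  case False
  have KG: "K \<in> sets (restrict_space borel G)"
    using K by (auto simp: sets_restrict_space image_iff intro!: bexI[of _ K] borel_compact)
  obtain k where k: "k \<in> K" "\<forall>g\<in>K. left_scale k \<le> left_scale g"
    using continuous_attains_inf[OF K(1) False continuous_on_left_scale[OF continuous_on_id]] by auto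
  have k_pos: "0 < left_scale k"
    using left_scale_pos k K by blast
  have "bounded K"
    using K(1) by (rule compact_imp_bounded)
  then obtain R where R: "\<And>g. g \<in> K \<Longrightarrow> norm g \<le> R"
    by (auto simp: bounded_iff)
  have R0: "0 \<le> R"
    using R[OF k(1)] norm_ge_zero order_trans by blast
  have "\<exists>K0>0. \<forall>(A :: real^'d^'d) B :: real^'d^'d. norm (A ** B) \<le> norm A * norm B * K0"
    by (rule matrix_mult.pos_bounded)
  then obtain M where M: "0 < M" "\<And>(A :: real^'d^'d) B :: real^'d^'d. norm (A ** B) \<le> norm A * norm B * M"
    by auto
  define R' where "R' = R * (norm (mat 1 :: real^'d^'d) + \<epsilon>) * M"
  have bound: "ennreal (weight X) * indicator K (foot X) \<le> ennreal (1 / left_scale k) * indicator (cball 0 R') X" for X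
  proof (cases "X \<in> Tube \<and> foot X \<in> K")
    case True
    then obtain n where n: "n \<in> normal_disc" "X = foot X ** (mat 1 + n)"
      using TubeE by blast
    have "norm X \<le> norm (foot X) * norm (mat 1 + n) * M"
      by (subst n(2)) (rule M(2))
    also have "\<dots> \<le> R'"
      unfolding R'_def
    proof (intro mult_right_mono mult_mono)
      show "norm (mat 1 + n) \<le> norm (mat 1 :: real^'d^'d) + \<epsilon>"
        using norm_triangle_ineq[of "mat 1" n] n by (simp add: normal_disc_def)
    qed (use R[of "foot X"] True R0 M(1) in auto)
    finally have "X \<in> cball 0 R'"
      by simp
    moreover have "weight X \<le> 1 / left_scale k"
      using True k(2) k_pos by (simp add: weight_def frac_le)
    ultimately show ?thesis
      using True by (simp add: ennreal_leI)
  qed (auto simp: weight_def indicator_def)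
  have "emeasure haar K \<le> (\<integral>\<^sup>+X. ennreal (1 / left_scale k) * indicator (cball 0 R') X \<partial>ambient_lebesgue)"
    unfolding emeasure_haar[OF KG] by (intro nn_integral_mono bound)
  also have "\<dots> = ennreal (1 / left_scale k) * emeasure ambient_lebesgue (cball 0 R')"
    by (simp add: nn_integral_cmult_indicator)
  also have "\<dots> < \<infinity>"
    using ambient_lebesgue_bounded_finite[of "cball 0 R'"] by (simp add: ennreal_mult_less_top)
  finally show ?thesis .
qed simp

lemma borel_measure_on_haar: "borel_measure_on G haar"
  unfolding borel_measure_on_def using haar_compact_finite by auto

section \<open>The density in exponential charts\<close>

definition horizontal_factor :: "real^'d^'d \<Rightarrow> real^'d^'d \<Rightarrow> real^'d^'d" where
  "horizontal_factor x h = left_dmexp x (P h) + Q h"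

definition normal_factor :: "real^'d^'d \<Rightarrow> real^'d^'d \<Rightarrow> real^'d^'d" where
  "normal_factor n h = P h ** (mat 1 + n) + Q h"

lemma linear_horizontal_factor: "linear (horizontal_factor x)"
  unfolding horizontal_factor_def
  using linear_compose[OF P(1) linear_left_dmexp] linear_Q
  by (auto intro!: linear_compose_add simp: o_def)

lemma linear_normal_factor: "linear (normal_factor n)"
  unfolding normal_factor_def
  by (intro linear_compose_add linear_Q bounded_linear.linear
      bounded_linear_compose[OF matrix_mult.bounded_linear_left bounded_linear_P])

text \<open>The horizontal factor depends only on the point \<open>x\<close> of the Lie algebra, the normal factor only on the
normal coordinate. The factorisation rests on \<open>left_dmexp x\<close> preserving \<open>L\<close>: otherwise \<open>P\<close> and \<open>Q\<close>
would not recover the two summands of \<open>horizontal_factor x h\<close>.\<close>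

lemma dtube_map_factors:
  assumes "x \<in> L" "P z = x"
  shows "dtube_map z h = mexp x ** normal_factor (Q z) (horizontal_factor x h)"
proof -
  have PP: "left_dmexp x (P h) \<in> L"
    by (rule left_dmexp_in_L[OF assms(1) P_in_L])
  have "P (horizontal_factor x h) = left_dmexp x (P h)" "Q (horizontal_factor x h) = Q h"
    using P_add_normal[OF PP P_Q] Q_add_normal[OF PP P_Q] by (simp_all add: horizontal_factor_def)
  then show ?thesis
    unfolding dtube_map_def normal_factor_def
    by (simp add: assms(2) dmexp_eq_left matrix_mult.add_right matrix_mul_assoc add.commute)
qed

lemma abs_det_dtube_chart:
  "abs_det (\<lambda>h. g ** dtube_map z h)
    = left_scale (g ** mexp (P z)) * (abs_det (normal_factor (Q z)) * abs_det (horizontal_factor (P z)))"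
proof -
  have "abs_det (\<lambda>h. g ** dtube_map z h)
      = abs_det (\<lambda>h. (g ** mexp (P z)) ** normal_factor (Q z) (horizontal_factor (P z) h))"
    by (simp only: dtube_map_factors[OF P_in_L refl] matrix_mul_assoc)
  also have "\<dots> = left_scale (g ** mexp (P z)) *
      abs_det (\<lambda>h. normal_factor (Q z) (horizontal_factor (P z) h))"
    unfolding left_scale_def
    by (rule abs_det_wrt_compose[OF T(1,2) linear_matrix_mult_left])
      (rule linear_compose[OF linear_horizontal_factor linear_normal_factor, unfolded o_def])
  also have "abs_det (\<lambda>h. normal_factor (Q z) (horizontal_factor (P z) h))
      = abs_det (normal_factor (Q z)) * abs_det (horizontal_factor (P z))"
    by (rule abs_det_wrt_compose[OF T(1,2) linear_normal_factor linear_horizontal_factor])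
  finally show ?thesis .
qed

lemma abs_det_horizontal_pos:
  assumes "x \<in> L" "x \<in> U"
  shows "0 < abs_det (horizontal_factor x)"
proof (rule abs_det_wrt_pos[OF T(1,2) linear_horizontal_factor])
  fix h assume h: "horizontal_factor x h = 0"
  have LP: "left_dmexp x (P h) \<in> L"
    by (rule left_dmexp_in_L[OF assms(1) P_in_L])
  have "left_dmexp x (P h) = P (horizontal_factor x h)" "Q h = Q (horizontal_factor x h)"
    using P_add_normal[OF LP P_Q] Q_add_normal[OF LP P_Q] by (simp_all add: horizontal_factor_def)
  then have "left_dmexp x (P h) = 0" "Q h = 0"
    by (simp_all add: h)
  then have "dmexp x (P h) = 0"
    by (simp add: dmexp_eq_left matrix_mult.zero_right)
  then have "P h = 0"
    by (rule dmexp_injective[OF assms(2)])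
  with \<open>Q h = 0\<close> show "h = 0"
    by (simp add: Q_def)
qed

lemma continuous_on_abs_det_horizontal: "continuous_on S (\<lambda>x. abs_det (horizontal_factor x))"
  unfolding horizontal_factor_def left_dmexp_def
  by (intro continuous_on_abs_det_wrt[OF T(1,2)] continuous_intros continuous_on_dmexp)

lemma continuous_on_abs_det_normal: "continuous_on S (\<lambda>n. abs_det (normal_factor n))"
  unfolding normal_factor_def
  by (intro continuous_on_abs_det_wrt[OF T(1,2)] continuous_intros)

definition normal_weight :: "real^'d^'d \<Rightarrow> real" where
  "normal_weight n = indicator (ball 0 \<epsilon>) n * abs_det (normal_factor n)"

lemma abs_det_nonneg: "0 \<le> abs_det f"
  by (simp add: abs_det_wrt_def)

lemma normal_weight_nonneg: "0 \<le> normal_weight n"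
  by (simp add: normal_weight_def abs_det_nonneg)

lemma normal_weight_measurable [measurable]: "normal_weight \<in> borel_measurable borel"
  using borel_measurable_continuous_on_indicator[OF _ continuous_on_abs_det_normal, of "ball 0 \<epsilon>"]
  by (simp add: normal_weight_def[abs_def])

abbreviation "C \<equiv> extend_basis B - B"

lemma basis_split: "B \<union> C = extend_basis B" "B \<inter> C = {}" "finite B" "finite C"
  using extend_basis_superset[OF indep] finiteI_independent[OF indep]
    finiteI_independent[OF independent_extend_basis[OF indep]] by auto

lemma P_measurable [measurable]: "P \<in> borel_measurable borel"
  and Q_measurable [measurable]: "Q \<in> borel_measurable borel"
  by (intro borel_measurable_linear P(1) linear_Q)+

text \<open>By Fubini's theorem, the integral times the measure of a ball in \<open>L\<close> is an integral over a bounded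
subset of the space of matrices, with bounded integrand that is positive near \<open>0\<close>. A product that is
neither \<open>0\<close> nor \<open>\<infinity>\<close> has no factor \<open>0\<close> or \<open>\<infinity>\<close>.\<close>

lemma normal_weight_integral:
  "(\<integral>\<^sup>+n. ennreal (normal_weight n) \<partial>coord_lebesgue C) \<noteq> 0"
  "(\<integral>\<^sup>+n. ennreal (normal_weight n) \<partial>coord_lebesgue C) \<noteq> \<infinity>"
proof -
  let ?I = "\<integral>\<^sup>+n. ennreal (normal_weight n) \<partial>coord_lebesgue C"
  let ?f = "\<lambda>z. indicator (ball 0 1) (P z) * ennreal (normal_weight (Q z))"
  have split: "(\<integral>\<^sup>+z. ?f z \<partial>ambient_lebesgue) = emeasure (coord_lebesgue B) (ball 0 1) * ?I"
    using nn_integral_coord_lebesgue_split[OF basis_split(3,4,2) P, of "ball 0 1" normal_weight,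
        unfolded basis_split(1)]
    by (simp add: ambient_lebesgue_def Q_def)
  have "(\<integral>\<^sup>+z. ?f z \<partial>ambient_lebesgue) \<noteq> 0"
  proof (rule nn_integral_ambient_nonzero)
    let ?A = "{z. norm (P z) < 1} \<inter> {z. norm (Q z) < \<epsilon>} \<inter> {z. 0 < abs_det (normal_factor (Q z))}"
    have "continuous_on UNIV (\<lambda>z. abs_det (normal_factor (Q z)))"
      by (rule continuous_on_compose2[OF continuous_on_abs_det_normal[of UNIV]]) (auto intro!: continuous_intros)
    then show "open ?A"
      by (intro open_Int open_Collect_less continuous_intros)
    have "normal_factor 0 = (\<lambda>h. h)"
      by (simp add: normal_factor_def Q_def fun_eq_iff)
    then have "0 \<in> ?A"
      using \<epsilon>_pos by (simp add: abs_det_wrt_ident[OF T(1,2)])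
    then show "?A \<noteq> {}" by blast
    show "?f z \<noteq> 0" if "z \<in> ?A" for z
      using that by (simp add: normal_weight_def)
    have "(\<lambda>z. ennreal (normal_weight (Q z))) \<in> borel_measurable borel"
      by (rule measurable_compose[OF Q_measurable]) measurable
    moreover have "(\<lambda>z. indicator (ball 0 1) (P z) :: ennreal) \<in> borel_measurable borel"
      by (rule measurable_compose[OF P_measurable borel_measurable_indicator]) simp
    ultimately show "?f \<in> borel_measurable borel"
      by (rule borel_measurable_times_ennreal[rotated])
  qed
  moreover have "(\<integral>\<^sup>+z. ?f z \<partial>ambient_lebesgue) < \<infinity>"
  proof -
    have "compact ((\<lambda>n. abs_det (normal_factor n)) ` cball 0 \<epsilon>)"
      by (intro compact_continuous_image continuous_on_abs_det_normal) simp
    from compact_imp_bounded[OF this]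
    obtain M where "\<forall>y\<in>(\<lambda>n. abs_det (normal_factor n)) ` cball 0 \<epsilon>. norm y \<le> M"
      unfolding bounded_iff ..
    then have M: "abs_det (normal_factor n) \<le> M" if "n \<in> cball 0 \<epsilon>" for n
      using that abs_ge_self order_trans unfolding real_norm_def by blast
    have "?f z \<le> ennreal M * indicator (cball 0 (1 + \<epsilon>)) z" for z
    proof (cases "norm (P z) < 1 \<and> norm (Q z) < \<epsilon>")
      case True
      then have "norm z \<le> 1 + \<epsilon>"
        using norm_triangle_ineq[of "P z" "Q z"] by (simp add: Q_def)
      moreover have "normal_weight (Q z) \<le> M"
        using True M[of "Q z"] by (simp add: normal_weight_def)
      ultimately show ?thesis
        using True by (simp add: ennreal_leI)
    qed (auto simp: normal_weight_def)
    then have "(\<integral>\<^sup>+z. ?f z \<partial>ambient_lebesgue) \<le> (\<integral>\<^sup>+z. ennreal M * indicator (cball 0 (1 + \<epsilon>)) z \<partial>ambient_lebesgue)"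
      by (rule nn_integral_mono)
    also have "\<dots> = ennreal M * emeasure ambient_lebesgue (cball 0 (1 + \<epsilon>))"
      by (simp add: nn_integral_cmult_indicator)
    also have "\<dots> < \<infinity>"
      using ambient_lebesgue_bounded_finite[of "cball 0 (1 + \<epsilon>)"] by (simp add: ennreal_mult_less_top)
    finally show ?thesis .
  qed
  ultimately show "?I \<noteq> 0" "?I \<noteq> \<infinity>"
    unfolding split by (auto simp: ennreal_mult_less_top)
qed

definition \<kappa> :: real where
  "\<kappa> = enn2real (\<integral>\<^sup>+n. ennreal (normal_weight n) \<partial>coord_lebesgue C)"

lemma \<kappa>: "0 < \<kappa>" "(\<integral>\<^sup>+n. ennreal (normal_weight n) \<partial>coord_lebesgue C) = ennreal \<kappa>"
  using normal_weight_integral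
  by (auto simp: \<kappa>_def enn2real_positive_iff less_top zero_less_iff_neq_zero)

text \<open>Over the support of \<open>f\<close> the tube is covered by the single chart \<open>x + n \<mapsto> g exp x (1 + n)\<close>. After the
change of variables the integrand is a function of \<open>n\<close> times a function of \<open>x\<close>, and Fubini's theorem
turns the former into the constant \<open>\<kappa>\<close>.\<close>

theorem integral_haar_chart:
  assumes g: "g \<in> G" and f: "f \<in> Cc G"
    and supp: "supp_in G f \<subseteq> (\<lambda>x. g ** mexp x) ` (L \<inter> U)"
  shows "(\<integral>x. f x \<partial>haar)
    = (LINT x : L \<inter> U | coord_lebesgue B. f (g ** mexp x) * (\<kappa> * abs_det (horizontal_factor x)))"
proof -
  let ?\<phi> = "\<lambda>z. g ** tube_map z"
  let ?h = "\<lambda>X. f (foot X) / left_scale (foot X)"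
  let ?H = "\<lambda>x. indicator (L \<inter> U) x * (f (g ** mexp x) * abs_det (horizontal_factor x))"
  have LU [measurable]: "L \<inter> U \<in> sets borel"
    using closed_subspace[OF subspace_L] U(1) by auto
  have H_meas [measurable]: "?H \<in> borel_measurable borel"
  proof -
    have "continuous_on G f"
      using f by (simp add: Cc_def)
    then have "continuous_on (L \<inter> U) (\<lambda>x. f (g ** mexp x))"
      by (rule continuous_on_compose2) (auto intro!: continuous_intros mult_in_G g mexp_in_G)
    from borel_measurable_continuous_on_indicator[OF LU continuous_on_mult[OF this continuous_on_abs_det_horizontal]]
    show ?thesis by simp
  qed
  have outside: "f (foot X) = 0" if "X \<in> Tube" "X \<notin> ?\<phi> ` chart_domain" for X
  proof (rule ccontr)
    assume "f (foot X) \<noteq> 0"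
    then have "foot X \<in> supp_in G f"
      using closure_subset[of "{x \<in> G. f x \<noteq> 0}"] foot_in_G by (auto simp: supp_in_def)
    then obtain x where "foot X = g ** mexp x" "x \<in> L" "x \<in> U"
      using supp by auto
    then show False
      using mem_tube_chart that by blast
  qed
  \<comment> \<open>By the support condition on \<open>f\<close>, only the part of the tube inside the chart contributes.\<close>
  have restrict: "indicator Tube X * ?h X = indicator (?\<phi> ` chart_domain) X * ?h X" for X
    using outside[of X] tube_map_chart(1)[OF g] by (auto simp: indicator_def)
  \<comment> \<open>The scaling factor of left multiplication cancels the denominator of \<open>?h\<close>.\<close>
  have pull: "indicator chart_domain z * (abs_det (\<lambda>h. g ** dtube_map z h) * ?h (?\<phi> z))
      = normal_weight (z - P z) * ?H (P z)" for z
  proof (cases "z \<in> chart_domain")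
    case True
    have "0 < left_scale (g ** mexp (P z))"
      by (intro left_scale_pos mult_in_G g mexp_in_G P_in_L)
    with True show ?thesis
      unfolding abs_det_dtube_chart tube_map_chart(2)[OF g True]
      by (simp add: normal_weight_def chart_domain_def P_in_L Q_def[symmetric])
  qed (auto simp: chart_domain_def normal_weight_def Q_def[symmetric])
  have meas: "(\<lambda>X. indicator Tube X * ?h X) \<in> borel_measurable borel"
    by (rule foot_compose_measurable[OF Cc_measurable[OF f]])
  have "(\<integral>x. f x \<partial>haar) = (\<integral>X. indicator (?\<phi> ` chart_domain) X * ?h X \<partial>ambient_lebesgue)"
    by (simp only: integral_haar[OF Cc_measurable[OF f]] restrict)
  also have "\<dots> = (\<integral>z. indicator chart_domain z * (abs_det (\<lambda>h. g ** dtube_map z h) * ?h (?\<phi> z)) \<partial>ambient_lebesgue)"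
    unfolding ambient_lebesgue_eq
  proof (rule integral_change_of_variables_wrt[OF T(1,2)])
    show "chart_domain \<in> sets borel"
      using open_chart_domain by simp
    show "(?\<phi> has_derivative (\<lambda>h. g ** dtube_map z h)) (at z)" for z
      by (rule bounded_linear.has_derivative[OF matrix_mult.bounded_linear_right has_derivative_tube_map])
    show "inj_on ?\<phi> chart_domain"
      by (rule inj_on_tube_chart[OF g])
    show "(\<lambda>X. indicator (?\<phi> ` chart_domain) X * ?h X) \<in> borel_measurable borel"
      using meas by (simp only: restrict)
    show "(\<lambda>z. indicator chart_domain z * (abs_det (\<lambda>h. g ** dtube_map z h) * ?h (?\<phi> z))) \<in> borel_measurable borel"
      unfolding pull by measurable
  qed
  also have "\<dots> = (\<integral>z. normal_weight (z - P z) * ?H (P z) \<partial>coord_lebesgue (B \<union> C))"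
    by (simp only: pull basis_split(1) ambient_lebesgue_def)
  also have "\<dots> = \<kappa> * (\<integral>x. ?H x \<partial>coord_lebesgue B)"
    using \<kappa> by (intro integral_coord_lebesgue_split basis_split P normal_weight_nonneg
        normal_weight_measurable H_meas) auto
  also have "\<dots> = (\<integral>x. \<kappa> * ?H x \<partial>coord_lebesgue B)"
    by simp
  also have "\<dots> = (LINT x : L \<inter> U | coord_lebesgue B. f (g ** mexp x) * (\<kappa> * abs_det (horizontal_factor x)))"
    unfolding set_lebesgue_integral_def by (simp add: mult_ac)
  finally show ?thesis .
qed

theorem real_analytic_density:
  "real_analytic_on B (\<lambda>x. \<kappa> * abs_det (horizontal_factor x)) (L \<inter> U)"
proof (rule real_analytic_on_abs_det_wrt[OF T(1,2) basis_split(3)])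
  fix a assume a: "a \<in> L \<inter> U"
  then obtain \<rho> where \<rho>: "0 < \<rho>" "ball a \<rho> \<subseteq> U"
    using U(1) open_contains_ball by blast
  define s where "s = 1 + (\<Sum>v\<in>B. norm v)"
  have s: "0 < s"
    by (auto simp: s_def intro!: add_pos_nonneg sum_nonneg)
  have "a + (\<Sum>v\<in>B. t v *\<^sub>R v) \<in> L \<inter> U" if t: "\<forall>v\<in>B. \<bar>t v\<bar> < \<rho> / s" for t
  proof
    have "v \<in> L" if "v \<in> B" for v
      using that span_base span_B by blast
    then show "a + (\<Sum>v\<in>B. t v *\<^sub>R v) \<in> L"
      using a subspace_L by (intro subspace_add subspace_sum subspace_scale) auto
    have "norm (t v *\<^sub>R v) \<le> \<rho> / s * norm v" if "v \<in> B" for v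
      unfolding norm_scaleR using t that by (intro mult_right_mono) (auto simp: less_imp_le)
    then have "norm (\<Sum>v\<in>B. t v *\<^sub>R v) \<le> (\<Sum>v\<in>B. \<rho> / s * norm v)"
      by (rule sum_norm_le)
    also have "\<dots> = \<rho> / s * (s - 1)"
      by (simp add: s_def sum_distrib_left)
    also have "\<dots> < \<rho>"
      using s \<rho>(1) by (simp add: field_simps)
    finally show "a + (\<Sum>v\<in>B. t v *\<^sub>R v) \<in> U"
      using \<rho>(2) by (auto simp: dist_norm)
  qed
  then show "\<exists>r>0. \<forall>t. (\<forall>v\<in>B. \<bar>t v\<bar> < r) \<longrightarrow> a + (\<Sum>v\<in>B. t v *\<^sub>R v) \<in> L \<inter> U"
    using s \<rho>(1) by (intro exI[of _ "\<rho> / s"]) auto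
next
  fix a v i j and r :: real
  assume r: "0 < r"
  let ?x = "\<lambda>t. a + (\<Sum>v\<in>B. t v *\<^sub>R v)"
  have lin: "linear (\<lambda>A :: real^'d^'d. A $ i $ j)" "linear (\<lambda>A :: real^'d^'d. (- A) $ i $ j)" for i j
    by (auto intro!: linearI)
  have x: "has_power_series B r (\<lambda>t. ?x t $ i $ j)" "has_power_series B r (\<lambda>t. (- ?x t) $ i $ j)" for i j
    using has_power_series_affine[OF basis_split(3) r lin(1)] has_power_series_affine[OF basis_split(3) r lin(2)]
    by auto
  show "has_power_series B r (\<lambda>t. horizontal_factor (?x t) v $ i $ j)"
    unfolding horizontal_factor_def left_dmexp_def vector_add_component
    by (intro has_power_series_add has_power_series_const has_power_series_matrix_product
        has_power_series_mexp has_power_series_dmexp r x)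
next
  show "abs_det (horizontal_factor x) \<noteq> 0" if "x \<in> L \<inter> U" for x
    using abs_det_horizontal_pos[of x] that by simp
qed

end

section \<open>Existence of the analytic left-invariant measure\<close>

theorem theorem2p3:
  fixes G U B :: "(real^'d^'d) set"
  assumes "matrix_lie_group G"
    and "exp_neighbourhood G U"
    and "independent B" and "span B = lie_algebra G"
  shows "\<exists>m. borel_measure_on G m \<and> emeasure m G \<noteq> 0 \<and> left_invariant G m \<and>
    (\<forall>g\<in>G. \<exists>\<delta> :: real^'d^'d \<Rightarrow> real.
      real_analytic_on B \<delta> (lie_algebra G \<inter> U) \<and>
      (\<forall>x \<in> lie_algebra G \<inter> U. \<delta> x > 0) \<and>
      (\<forall>f \<in> Cc G. supp_in G f \<subseteq> (\<lambda>x. g ** mexp x) ` (lie_algebra G \<inter> U) \<longrightarrow>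
        (\<integral>x. f x \<partial>m) =
        (LINT x : lie_algebra G \<inter> U | coord_lebesgue B. f (g ** mexp x) * \<delta> x)))"
proof -
  have ext: "independent (extend_basis B)" "span (extend_basis B) = UNIV"
    using independent_extend_basis[OF assms(3)] span_extend_basis[OF assms(3)] by auto
  obtain T :: "real^((real^'d^'d) coord_index) \<Rightarrow> real^'d^'d"
    where T: "linear T" "bij T" "bij_betw T Basis (extend_basis B)"
    using exists_basis_coordinates[OF ext] .
  \<comment> \<open>The values on a basis of a projection onto the Lie algebra.\<close>
  define p where "p = (\<lambda>v. if v \<in> B then v else 0)"
  obtain P where P: "linear P" "\<forall>v\<in>extend_basis B. P v = p v"
    using linear_independent_extend[OF ext(1), of p] by auto
  interpret lie_group_coordinates G U B T P
  proof (rule lie_group_coordinates.intro)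
    show "P v = v" if "v \<in> B" for v
      using bspec[OF P(2) subsetD[OF extend_basis_superset[OF assms(3)] that]] that by (simp add: p_def)
    show "P v = 0" if "v \<in> extend_basis B - B" for v
      using bspec[OF P(2), of v] that by (simp add: p_def)
  qed (fact assms T P(1))+
  obtain \<epsilon> where "0 < \<epsilon>" "\<forall>g\<in>G. \<forall>g'\<in>G. \<forall>n n'. P n = 0 \<longrightarrow> P n' = 0 \<longrightarrow> norm n < \<epsilon> \<longrightarrow> norm n' < \<epsilon> \<longrightarrow>
      g ** (mat 1 + n) = g' ** (mat 1 + n') \<longrightarrow> g = g' \<and> n = n'"
    using tube_radius .
  then interpret lie_group_tube G U B T P \<epsilon>
    by unfold_locales
  let ?\<delta> = "\<lambda>x. \<kappa> * abs_det (horizontal_factor x)"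
  have "?\<delta> x > 0" if "x \<in> L \<inter> U" for x
    using \<kappa>(1) abs_det_horizontal_pos that by simp
  then have chart: "\<exists>\<delta> :: real^'d^'d \<Rightarrow> real.
      real_analytic_on B \<delta> (L \<inter> U) \<and> (\<forall>x \<in> L \<inter> U. \<delta> x > 0) \<and>
      (\<forall>f \<in> Cc G. supp_in G f \<subseteq> (\<lambda>x. g ** mexp x) ` (L \<inter> U) \<longrightarrow>
        (\<integral>x. f x \<partial>haar) = (LINT x : L \<inter> U | coord_lebesgue B. f (g ** mexp x) * \<delta> x))"
    if "g \<in> G" for g
    using real_analytic_density integral_haar_chart[OF that] by (intro exI[of _ ?\<delta>]) simp
  show ?thesis
    by (intro exI[of _ haar] conjI ballI chart borel_measure_on_haar haar_nonzero left_invariant_haar)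
qed

end
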